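(* Let $\mu\in\mathcal P(\mathcal X)$, $\nu\in\mathcal P(\mathcal Y)$, $P=\mu\otimes\nu$, and let $\gamma\in\mathcal P(\mathcal X\times\mathcal Y)$ have density $\frac{d\gamma}{dP}=\exp(g)$ for some measurable and bounded function $g$. Let $\pi\in\Pi_c(\mu,* )$ and $s_{\mathcal X}\in\mathcal S_{\mathcal X,\mu}$ be such that $$\frac{d\pi}{dP}=\exp(s_{\mathcal X}+g).$$ Then $\pi$ is the unique minimizer of $\min_{\tilde\pi\in\Pi_c(\mu,* )}D_{\rm KL}(\tilde\pi,\gamma)$. Moreover, $s_{\mathcal X}$ can be decomposed as a sum $s_{\mathcal X}=\sum_{t=1}^Nf_t$ ($P$-almost surely), where $f_t\in\mathcal A_{\mathcal X,\mu,t}$ are explicitly given by the following recursion: set $g_N=g$ and, for $t=N-1,\dots,1$, $$a_{t+1}:=-\log\int\exp(g_{t+1})\,d\nu_{t+1}^{Y_{1:t}},\qquad g_t:=-\int a_{t+1}\,d\mu_{t+1}^{X_{1:t}},\qquad f_{t+1}:=a_{t+1}+g_t,$$ and $f_1=-\log\int\exp(g_1)\,d\nu_1$.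
   Context: $N\in\mathbb N$; $\mathcal X=\mathcal X_1\times\dots\times\mathcal X_N$ and $\mathcal Y=\mathcal Y_1\times\dots\times\mathcal Y_N$ are products of Polish spaces; $X_t,Y_t$ are coordinate projections, $x_{1:t}=(x_1,\dots,x_t)$, $\mathcal X_{1:t}=\mathcal X_1\times\dots\times\mathcal X_t$, etc. $\mu_{t+1}^{x_{1:t}}$ is the regular conditional law of $X_{t+1}$ given $X_{1:t}=x_{1:t}$ under $\mu$; $\nu_1$ is the law of $Y_1$ and $\nu_{t+1}^{y_{1:t}}$ the conditional law of $Y_{t+1}$ given $Y_{1:t}=y_{1:t}$ under $\nu$. In the recursion $g_t$ is a function of $(x_{1:t},y_{1:t})$, $a_{t+1}(x_{1:t+1},y_{1:t})=-\log\int\exp(g_{t+1}(x_{1:t+1},y_{1:t},\tilde y_{t+1}))\,\nu_{t+1}^{y_{1:t}}(d\tilde y_{t+1})$ and $g_t(x_{1:t},y_{1:t})=-\int a_{t+1}(x_{1:t},\tilde x_{t+1},y_{1:t})\,\mu_{t+1}^{x_{1:t}}(d\tilde x_{t+1})$. A measure $\pi\in\mathcal P(\mathcal X\times\mathcal Y)$ is causal if under $\pi$, for all $t=1,\dots,N-1$, $X_{t+1}$ is conditionally independent of $Y_{1:t}$ given $X_{1:t}$. $\Pi_c(\mu,* )$ is the set of causal measures with $\mathcal X$-marginal $\mu$ (and arbitrary $\mathcal Y$-marginal). $D_{\rm KL}(\pi,\tilde\pi)=\int\log\frac{d\pi}{d\tilde\pi}\,d\pi$ if $\pi\ll\tilde\pi$,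 $+\infty$ otherwise. $\mathcal A_{\mathcal X,\mu,1}$ is the set of bounded measurable functions of $x_1$; for $t=2,\dots,N$, $\mathcal A_{\mathcal X,\mu,t}$ is the set of functions $a_t(x_{1:t},y_{1:t-1})-\int a_t(x_{1:t-1},\tilde x_t,y_{1:t-1})\,\mu_t^{x_{1:t-1}}(d\tilde x_t)$ with $a_t:\mathcal X_{1:t}\times\mathcal Y_{1:t-1}\to\mathbb R$ bounded measurable. $\mathcal S_{\mathcal X,\mu}=\{\sum_{t=1}^Nf_t:f_t\in\mathcal A_{\mathcal X,\mu,t}\}$. *)

theory Defs
  imports "HOL-Probability.Probability"
begin

text \<open>
  The factors of a product may be different spaces, so each factor is an abstract topology
  on a common carrier type.
\<close>

definition polish_space :: "'a topology \<Rightarrow> bool" where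
  "polish_space T \<longleftrightarrow> completely_metrizable_space T \<and>
     (\<exists>C. countable C \<and> C \<subseteq> topspace T \<and> T closure_of C = topspace T)"

definition borel_of :: "'a topology \<Rightarrow> 'a measure" where
  "borel_of T = sigma (topspace T) {U. openin T U}"

text \<open>
  The space of \<open>x\<^sub>1\<^sub>:\<^sub>t\<close>. As the factors are second countable, the product \<open>\<sigma>\<close>-algebra is the
  Borel \<open>\<sigma>\<close>-algebra of the product topology. Points are functions that are \<open>undefined\<close>
  outside \<open>{1..t}\<close>; for \<open>t = 0\<close> there is exactly one point.
\<close>

definition hist :: "(nat \<Rightarrow> 'a topology) \<Rightarrow> nat \<Rightarrow> (nat \<Rightarrow> 'a) measure" where
  "hist X t = (\<Pi>\<^sub>M i\<in>{1..t}. borel_of (X i))"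

definition proj :: "nat \<Rightarrow> (nat \<Rightarrow> 'a) \<Rightarrow> (nat \<Rightarrow> 'a)" where
  "proj t x = restrict x {1..t}"

definition path_pair :: "(nat \<Rightarrow> 'a topology) \<Rightarrow> (nat \<Rightarrow> 'b topology) \<Rightarrow> nat \<Rightarrow>
    ((nat \<Rightarrow> 'a) \<times> (nat \<Rightarrow> 'b)) measure" where
  "path_pair X Y N = hist X N \<Otimes>\<^sub>M hist Y N"

definition bounded_measurable :: "'w measure \<Rightarrow> ('w \<Rightarrow> real) set" where
  "bounded_measurable M = {f \<in> borel_measurable M. bounded (f ` space M)}"

text \<open>
  \<open>\<kappa> (Suc t) u\<close> is the conditional law of the coordinate \<open>Suc t\<close> given that the first \<open>t\<close>
  coordinates are \<open>u\<close>. Such kernels exist on Polish spaces and are unique up to null sets;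
  the predicate says that \<open>\<kappa>\<close> is one version of them.
\<close>

definition regular_cond_laws ::
  "(nat \<Rightarrow> 'a topology) \<Rightarrow> nat \<Rightarrow> (nat \<Rightarrow> 'a) measure \<Rightarrow> (nat \<Rightarrow> (nat \<Rightarrow> 'a) \<Rightarrow> 'a measure) \<Rightarrow> bool" where
  "regular_cond_laws X N \<mu> \<kappa> \<longleftrightarrow>
     (\<forall>t\<in>{1..<N}.
        \<kappa> (Suc t) \<in> measurable (hist X t) (prob_algebra (borel_of (X (Suc t)))) \<and>
        (\<forall>B\<in>sets (borel_of (X (Suc t))).
           AE x in \<mu>. measure (\<kappa> (Suc t) (proj t x)) B =
             real_cond_exp \<mu> (vimage_algebra (space \<mu>) (proj t) (hist X t))
               (\<lambda>x. indicator B (x (Suc t))) x))"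

definition cond_indep_var ::
  "'w measure \<Rightarrow> 'u measure \<Rightarrow> ('w \<Rightarrow> 'u) \<Rightarrow> 'v measure \<Rightarrow> ('w \<Rightarrow> 'v) \<Rightarrow> 'c measure \<Rightarrow> ('w \<Rightarrow> 'c) \<Rightarrow> bool" where
  "cond_indep_var M A U B V C W \<longleftrightarrow>
     (let F = vimage_algebra (space M) W C in
      \<forall>a\<in>sets A. \<forall>b\<in>sets B. AE \<omega> in M.
        real_cond_exp M F (\<lambda>\<omega>. indicator a (U \<omega>) * indicator b (V \<omega>)) \<omega> =
        real_cond_exp M F (\<lambda>\<omega>. indicator a (U \<omega>)) \<omega> *
        real_cond_exp M F (\<lambda>\<omega>. indicator b (V \<omega>)) \<omega>)"

definition causal ::
  "(nat \<Rightarrow> 'a topology) \<Rightarrow> (nat \<Rightarrow> 'b topology) \<Rightarrow> nat \<Rightarrow> ((nat \<Rightarrow> 'a) \<times> (nat \<Rightarrow> 'b)) measure \<Rightarrow> bool" where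
  "causal X Y N \<pi> \<longleftrightarrow>
     (\<forall>t\<in>{1..<N}. cond_indep_var \<pi>
        (borel_of (X (Suc t))) (\<lambda>(x, y). x (Suc t))
        (hist Y t) (\<lambda>(x, y). proj t y)
        (hist X t) (\<lambda>(x, y). proj t x))"

definition causal_plans ::
  "(nat \<Rightarrow> 'a topology) \<Rightarrow> (nat \<Rightarrow> 'b topology) \<Rightarrow> nat \<Rightarrow> (nat \<Rightarrow> 'a) measure \<Rightarrow>
    ((nat \<Rightarrow> 'a) \<times> (nat \<Rightarrow> 'b)) measure set" where
  "causal_plans X Y N \<mu> =
     {\<pi> \<in> space (prob_algebra (path_pair X Y N)). causal X Y N \<pi> \<and> distr \<pi> (hist X N) fst = \<mu>}"

text \<open>
  The library's \<open>KL_divergence\<close> is real-valued and yields \<open>0\<close> when the integral diverges, so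
  the extended integral is formed here from the positive and the negative part of the
  logarithm. For probability measures the negative part always has a finite integral.
\<close>

definition ext_integral :: "'w measure \<Rightarrow> ('w \<Rightarrow> real) \<Rightarrow> ereal" where
  "ext_integral M f =
     enn2ereal (\<integral>\<^sup>+ w. ennreal (f w) \<partial>M) - enn2ereal (\<integral>\<^sup>+ w. ennreal (- f w) \<partial>M)"

definition D_KL :: "'w measure \<Rightarrow> 'w measure \<Rightarrow> ereal" where
  "D_KL \<pi> \<rho> =
     (if absolutely_continuous \<rho> \<pi>
      then ext_integral \<pi> (\<lambda>w. ln (enn2real (RN_deriv \<rho> \<pi> w)))
      else \<infinity>)"

text \<open>
  \<open>A_set X Y N \<kappa> t\<close> is \<open>\<A>\<^bsub>X,\<mu>,t\<^esub>\<close>, with \<open>\<kappa>\<close> the conditional laws of \<open>\<mu>\<close>. Its elements are viewed as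
  functions on the whole space \<open>X \<times> Y\<close>; values outside of that space are irrelevant.
\<close>

definition A_set ::
  "(nat \<Rightarrow> 'a topology) \<Rightarrow> (nat \<Rightarrow> 'b topology) \<Rightarrow> nat \<Rightarrow> (nat \<Rightarrow> (nat \<Rightarrow> 'a) \<Rightarrow> 'a measure) \<Rightarrow> nat \<Rightarrow>
    ((nat \<Rightarrow> 'a) \<times> (nat \<Rightarrow> 'b) \<Rightarrow> real) set" where
  "A_set X Y N \<kappa> t =
     (if t = 1 then
        {f. \<exists>a \<in> bounded_measurable (borel_of (X 1)).
              \<forall>(x, y) \<in> space (path_pair X Y N). f (x, y) = a (x 1)}
      else
        {f. \<exists>a \<in> bounded_measurable (hist X t \<Otimes>\<^sub>M hist Y (t - 1)).
              \<forall>(x, y) \<in> space (path_pair X Y N).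
                f (x, y) = a (proj t x, proj (t - 1) y)
                  - (\<integral>x'. a ((proj (t - 1) x)(t := x'), proj (t - 1) y) \<partial>\<kappa> t (proj (t - 1) x))})"

definition S_set ::
  "(nat \<Rightarrow> 'a topology) \<Rightarrow> (nat \<Rightarrow> 'b topology) \<Rightarrow> nat \<Rightarrow> (nat \<Rightarrow> (nat \<Rightarrow> 'a) \<Rightarrow> 'a measure) \<Rightarrow>
    ((nat \<Rightarrow> 'a) \<times> (nat \<Rightarrow> 'b) \<Rightarrow> real) set" where
  "S_set X Y N \<kappa> =
     {s. \<exists>f. (\<forall>t\<in>{1..N}. f t \<in> A_set X Y N \<kappa> t) \<and>
             (\<forall>z\<in>space (path_pair X Y N). s z = (\<Sum>t=1..N. f t z))}"

text \<open>
  \<open>a_step \<eta> t\<close> turns \<open>g\<^sub>t\<close> into \<open>a\<^sub>t\<close> by integrating out \<open>y\<^sub>t\<close>, and \<open>g_step \<kappa> t\<close> turns \<open>a\<^sub>t\<close> into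
  \<open>g\<^sub>t\<^sub>-\<^sub>1\<close> by integrating out \<open>x\<^sub>t\<close>. Here \<open>\<kappa>\<close> and \<open>\<eta>\<close> are the conditional laws of \<open>\<mu>\<close> and \<open>\<nu>\<close>,
  \<open>g\<^sub>t\<close> is applied to \<open>(x\<^sub>1\<^sub>:\<^sub>t, y\<^sub>1\<^sub>:\<^sub>t)\<close> and \<open>a\<^sub>t\<close> to \<open>(x\<^sub>1\<^sub>:\<^sub>t, y\<^sub>1\<^sub>:\<^sub>t\<^sub>-\<^sub>1)\<close>.
\<close>

definition a_step ::
  "(nat \<Rightarrow> (nat \<Rightarrow> 'b) \<Rightarrow> 'b measure) \<Rightarrow> nat \<Rightarrow> ((nat \<Rightarrow> 'a) \<times> (nat \<Rightarrow> 'b) \<Rightarrow> real) \<Rightarrow>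
    (nat \<Rightarrow> 'a) \<times> (nat \<Rightarrow> 'b) \<Rightarrow> real" where
  "a_step \<eta> t h = (\<lambda>(x, y). - ln (\<integral>y'. exp (h (x, y(t := y'))) \<partial>\<eta> t y))"

definition g_step ::
  "(nat \<Rightarrow> (nat \<Rightarrow> 'a) \<Rightarrow> 'a measure) \<Rightarrow> nat \<Rightarrow> ((nat \<Rightarrow> 'a) \<times> (nat \<Rightarrow> 'b) \<Rightarrow> real) \<Rightarrow>
    (nat \<Rightarrow> 'a) \<times> (nat \<Rightarrow> 'b) \<Rightarrow> real" where
  "g_step \<kappa> t a = (\<lambda>(x, y). - (\<integral>x'. a (x(t := x'), y) \<partial>\<kappa> t x))"

function g_rec ::
  "nat \<Rightarrow> (nat \<Rightarrow> (nat \<Rightarrow> 'a) \<Rightarrow> 'a measure) \<Rightarrow> (nat \<Rightarrow> (nat \<Rightarrow> 'b) \<Rightarrow> 'b measure) \<Rightarrow>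
    ((nat \<Rightarrow> 'a) \<times> (nat \<Rightarrow> 'b) \<Rightarrow> real) \<Rightarrow> nat \<Rightarrow> (nat \<Rightarrow> 'a) \<times> (nat \<Rightarrow> 'b) \<Rightarrow> real" where
  "g_rec N \<kappa> \<eta> g t =
     (if t < N then g_step \<kappa> (Suc t) (a_step \<eta> (Suc t) (g_rec N \<kappa> \<eta> g (Suc t))) else g)"
  by auto
termination
  by (relation "Wellfounded.measure (\<lambda>(N, \<kappa>, \<eta>, g, t). N - t)") auto

declare g_rec.simps [simp del]

definition a_rec ::
  "nat \<Rightarrow> (nat \<Rightarrow> (nat \<Rightarrow> 'a) \<Rightarrow> 'a measure) \<Rightarrow> (nat \<Rightarrow> (nat \<Rightarrow> 'b) \<Rightarrow> 'b measure) \<Rightarrow>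
    ((nat \<Rightarrow> 'a) \<times> (nat \<Rightarrow> 'b) \<Rightarrow> real) \<Rightarrow> nat \<Rightarrow> (nat \<Rightarrow> 'a) \<times> (nat \<Rightarrow> 'b) \<Rightarrow> real" where
  "a_rec N \<kappa> \<eta> g t = a_step \<eta> t (g_rec N \<kappa> \<eta> g t)"

text \<open>
  The potentials \<open>f\<^sub>t\<close> as functions on \<open>X \<times> Y\<close>. The measure \<open>\<nu>1\<close> is the law of \<open>Y\<^sub>1\<close>, and
  \<open>\<lambda>i\<in>{1}. y'\<close> is the path of length one with value \<open>y'\<close>.
\<close>

definition f_rec ::
  "nat \<Rightarrow> (nat \<Rightarrow> (nat \<Rightarrow> 'a) \<Rightarrow> 'a measure) \<Rightarrow> 'b measure \<Rightarrow> (nat \<Rightarrow> (nat \<Rightarrow> 'b) \<Rightarrow> 'b measure) \<Rightarrow>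
    ((nat \<Rightarrow> 'a) \<times> (nat \<Rightarrow> 'b) \<Rightarrow> real) \<Rightarrow> nat \<Rightarrow> (nat \<Rightarrow> 'a) \<times> (nat \<Rightarrow> 'b) \<Rightarrow> real" where
  "f_rec N \<kappa> \<nu>1 \<eta> g t = (\<lambda>(x, y).
     if t = 1 then - ln (\<integral>y'. exp (g_rec N \<kappa> \<eta> g 1 (proj 1 x, \<lambda>i\<in>{1}. y')) \<partial>\<nu>1)
     else a_rec N \<kappa> \<eta> g t (proj t x, proj (t - 1) y)
          + g_rec N \<kappa> \<eta> g (t - 1) (proj (t - 1) x, proj (t - 1) y))"

end

theory Submission
  imports Defs
begin

text \<open>
  Under a causal plan the conditional law of \<open>x\<^sub>t\<^sub>+\<^sub>1\<close> given \<open>(x\<^sub>1\<^sub>:\<^sub>t, y\<^sub>1\<^sub>:\<^sub>t)\<close> is the kernel of \<open>\<mu>\<close>, so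
  every element of \<open>\<S>\<close> has the same integral under all causal plans with first marginal \<open>\<mu>\<close>.
  As \<open>\<pi>\<close> has density \<open>exp s\<close> with respect to \<open>\<gamma>\<close>, the divergence from \<open>\<gamma>\<close> exceeds the one from \<open>\<pi>\<close>
  by the constant \<open>\<integral>s\<close>, which gives the unique minimiser.

  For the recursion, let \<open>s = f\<^sub>1 + \<dots> + f\<^sub>N\<close> and suppose that the law of \<open>(x\<^sub>1\<^sub>:\<^sub>t\<^sub>+\<^sub>1, y\<^sub>1\<^sub>:\<^sub>t\<^sub>+\<^sub>1)\<close> under \<open>\<pi>\<close>
  has density \<open>exp (f\<^sub>1 + \<dots> + f\<^sub>t\<^sub>+\<^sub>1 + g\<^sub>t\<^sub>+\<^sub>1)\<close>. Integrating out \<open>y\<^sub>t\<^sub>+\<^sub>1\<close> leaves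
  \<open>exp (f\<^sub>1 + \<dots> + f\<^sub>t\<^sub>+\<^sub>1 - a\<^sub>t\<^sub>+\<^sub>1)\<close>, and causality of \<open>\<pi>\<close> and \<open>P\<close> makes this density independent of
  \<open>x\<^sub>t\<^sub>+\<^sub>1\<close>. Hence \<open>f\<^sub>t\<^sub>+\<^sub>1 - a\<^sub>t\<^sub>+\<^sub>1\<close> equals its conditional mean over \<open>x\<^sub>t\<^sub>+\<^sub>1\<close>, which is \<open>g\<^sub>t\<close> because
  \<open>f\<^sub>t\<^sub>+\<^sub>1\<close> is conditionally centred; and the induction goes down to \<open>t = 1\<close>, where the first marginal
  of \<open>\<pi>\<close> being \<open>\<mu>\<close> determines \<open>f\<^sub>1\<close>.
\<close>

section \<open>Disintegration of integrals\<close>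

text \<open>Rectangles are stable under intersection and include the whole space, so finiteness of
  \<open>M\<close> on that one rectangle serves as the exhausting sequence.\<close>

lemma measure_eqI_rectangles:
  assumes M: "finite_measure M" "sets M = sets (A \<Otimes>\<^sub>M B)" and M': "sets M' = sets (A \<Otimes>\<^sub>M B)"
    and eq: "\<And>a b. a \<in> sets A \<Longrightarrow> b \<in> sets B \<Longrightarrow> emeasure M (a \<times> b) = emeasure M' (a \<times> b)"
  shows "M = M'"
proof (rule measure_eqI_generator_eq[OF Int_stable_pair_measure_generator[of A B],
      where \<Omega> = "space A \<times> space B" and A = "\<lambda>_. space A \<times> space B"])
  show "{a \<times> b |a b. a \<in> sets A \<and> b \<in> sets B} \<subseteq> Pow (space A \<times> space B)"
    by (auto dest: sets.sets_into_space)
  show "emeasure M (space A \<times> space B) \<noteq> \<infinity>" for i :: nat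
    using finite_measure.emeasure_finite[OF M(1)] by simp
qed (use M(2) M' eq in \<open>auto simp: sets_pair_measure\<close>)

text \<open>The law of \<open>(W, U)\<close> and the composition of the law of \<open>W\<close> with
  \<open>k\<close> agree on rectangles, hence everywhere, and integrating \<open>F\<close> against
  the composition is the iterated integral. It is applied with \<open>W\<close> a history of one
  process and with \<open>W\<close> a pair of histories.\<close>

lemma disintegration_rectangles:
  fixes F :: "'c \<times> 'a \<Rightarrow> real"
  assumes M: "prob_space M" and W[measurable]: "W \<in> measurable M C" and U[measurable]: "U \<in> measurable M A"
    and k: "k \<in> measurable C (prob_algebra A)"
    and eq: "\<And>c a. c \<in> sets C \<Longrightarrow> a \<in> sets A \<Longrightarrow>
      (\<integral>\<omega>. indicator c (W \<omega>) * indicator a (U \<omega>) \<partial>M) = (\<integral>\<omega>. indicator c (W \<omega>) * measure (k (W \<omega>)) a \<partial>M)"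
    and F[measurable]: "F \<in> borel_measurable (C \<Otimes>\<^sub>M A)" and bF: "bounded (F ` space (C \<Otimes>\<^sub>M A))"
  shows "(\<integral>\<omega>. F (W \<omega>, U \<omega>) \<partial>M) = (\<integral>\<omega>. (\<integral>a. F (W \<omega>, a) \<partial>k (W \<omega>)) \<partial>M)"
proof -
  interpret prob_space M by fact
  define D where "D = distr M C W"
  interpret D: prob_space D unfolding D_def by (rule prob_space_distr) simp
  \<comment> \<open>\<open>J w\<close> is the law of \<open>(w, a)\<close> with \<open>a\<close>
    drawn from \<open>k w\<close>, so \<open>D \<bind> J\<close> is the candidate for the joint
    law.\<close>
  define J where "J = (\<lambda>w. distr (k w) (C \<Otimes>\<^sub>M A) (\<lambda>a. (w, a)))"
  have ks[measurable]: "k \<in> measurable C (subprob_algebra A)"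
    using k by (rule measurable_prob_algebraD)
  have kw: "prob_space (k w)" "sets (k w) = sets A" if "w \<in> space C" for w
    using measurable_space[OF k that] by (auto simp: space_prob_algebra)
  have J[measurable]: "J \<in> measurable C (subprob_algebra (C \<Otimes>\<^sub>M A))"
    unfolding J_def by (rule measurable_distr2[OF _ ks]) simp
  have JD[measurable]: "J \<in> measurable D (subprob_algebra (C \<Otimes>\<^sub>M A))"
    unfolding D_def by simp
  have spD: "space D = space C" "sets D = sets C" by (auto simp: D_def)
  have Cne: "space C \<noteq> {}" using D.not_empty spD by simp
  have sJ: "sets (D \<bind> J) = sets (C \<Otimes>\<^sub>M A)"
    by (rule sets_bind[where N="C \<Otimes>\<^sub>M A"]) (use spD Cne in \<open>auto simp: J_def\<close>)
  obtain b where b: "\<And>z. z \<in> space (C \<Otimes>\<^sub>M A) \<Longrightarrow> \<bar>F z\<bar> \<le> b"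
    using bF by (auto simp: bounded_iff)
  have "distr M (C \<Otimes>\<^sub>M A) (\<lambda>\<omega>. (W \<omega>, U \<omega>)) = D \<bind> J"
  proof (rule measure_eqI_rectangles)
    show "finite_measure (distr M (C \<Otimes>\<^sub>M A) (\<lambda>\<omega>. (W \<omega>, U \<omega>)))"
      by (rule finite_measure_distr) simp
    fix c a assume c[measurable]: "c \<in> sets C" and a[measurable]: "a \<in> sets A"
    have int: "integrable M (\<lambda>\<omega>. indicator c (W \<omega>) * measure (k (W \<omega>)) a)"
    proof (rule integrable_const_bound[where B=1])
      show "AE \<omega> in M. norm (indicator c (W \<omega>) * measure (k (W \<omega>)) a) \<le> 1"
        using measurable_space[OF W] kw by (auto intro!: AE_I2 simp: indicator_def prob_space.prob_le_1)
    qed measurable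
    have "emeasure (distr M (C \<Otimes>\<^sub>M A) (\<lambda>\<omega>. (W \<omega>, U \<omega>))) (c \<times> a) = emeasure M {\<omega> \<in> space M. W \<omega> \<in> c \<and> U \<omega> \<in> a}"
      by (subst emeasure_distr) (auto intro!: arg_cong2[where f=emeasure])
    also have "\<dots> = ennreal (\<integral>\<omega>. indicator {\<omega> \<in> space M. W \<omega> \<in> c \<and> U \<omega> \<in> a} \<omega> \<partial>M)"
      by (subst Bochner_Integration.integral_indicator) (auto simp: emeasure_eq_measure Int_absorb2)
    also have "(\<integral>\<omega>. indicator {\<omega> \<in> space M. W \<omega> \<in> c \<and> U \<omega> \<in> a} \<omega> \<partial>M :: real) = (\<integral>\<omega>. indicator c (W \<omega>) * indicator a (U \<omega>) \<partial>M)"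
      by (rule Bochner_Integration.integral_cong) (auto simp: indicator_def)
    also have "\<dots> = (\<integral>\<omega>. indicator c (W \<omega>) * measure (k (W \<omega>)) a \<partial>M)"
      by (rule eq) fact+
    also have "ennreal \<dots> = (\<integral>\<^sup>+\<omega>. ennreal (indicator c (W \<omega>) * measure (k (W \<omega>)) a) \<partial>M)"
      by (rule nn_integral_eq_integral[symmetric]) (use int in auto)
    also have "\<dots> = (\<integral>\<^sup>+\<omega>. emeasure (J (W \<omega>)) (c \<times> a) \<partial>M)"
    proof (rule nn_integral_cong)
      fix \<omega> assume "\<omega> \<in> space M"
      then have w: "W \<omega> \<in> space C" using measurable_space[OF W] by auto
      interpret k: prob_space "k (W \<omega>)" by (rule kw[OF w])
      have [measurable_cong]: "sets (k (W \<omega>)) = sets A" by (rule kw[OF w])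
      have *: "emeasure (J (W \<omega>)) (c \<times> a) = emeasure (k (W \<omega>)) ((\<lambda>x. (W \<omega>, x)) -` (c \<times> a) \<inter> space (k (W \<omega>)))"
        unfolding J_def by (subst emeasure_distr) (use w in auto)
      have "(\<lambda>x. (W \<omega>, x)) -` (c \<times> a) \<inter> space (k (W \<omega>)) = (if W \<omega> \<in> c then a else {})"
        using sets.sets_into_space[OF a] sets_eq_imp_space_eq[OF kw(2)[OF w]] by auto
      then show "ennreal (indicator c (W \<omega>) * measure (k (W \<omega>)) a) = emeasure (J (W \<omega>)) (c \<times> a)"
        unfolding * by (auto simp: k.emeasure_eq_measure)
    qed
    also have "\<dots> = (\<integral>\<^sup>+w. emeasure (J w) (c \<times> a) \<partial>D)"
      unfolding D_def by (subst nn_integral_distr) auto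
    also have "\<dots> = emeasure (D \<bind> J) (c \<times> a)"
      by (subst emeasure_bind[OF _ JD]) (use D.not_empty in auto)
    finally show "emeasure (distr M (C \<Otimes>\<^sub>M A) (\<lambda>\<omega>. (W \<omega>, U \<omega>))) (c \<times> a) = emeasure (D \<bind> J) (c \<times> a)" .
  qed (use sJ in auto)
  then have "(\<integral>\<omega>. F (W \<omega>, U \<omega>) \<partial>M) = (\<integral>z. F z \<partial>(D \<bind> J))"
    by (subst integral_distr[of "\<lambda>\<omega>. (W \<omega>, U \<omega>)" M "C \<Otimes>\<^sub>M A", symmetric]) auto
  also have "\<dots> = (\<integral>w. (\<integral>z. F z \<partial>J w) \<partial>D)"
  proof (rule integral_bind[OF F b JD, where B'=1])
    show "AE x in D. emeasure (J x) (space (J x)) \<le> ennreal 1"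
      using subprob_space_kernel[OF JD] by (auto intro!: AE_I2 simp: subprob_space.emeasure_space_le_1)
  qed (auto intro: D.finite_measure_axioms)
  also have "\<dots> = (\<integral>w. (\<integral>a. F (w, a) \<partial>k w) \<partial>D)"
  proof (rule Bochner_Integration.integral_cong[OF refl])
    fix w assume "w \<in> space D"
    then have w: "w \<in> space C" by (simp add: spD)
    have [measurable_cong]: "sets (k w) = sets A" by (rule kw[OF w])
    show "(\<integral>z. F z \<partial>J w) = (\<integral>a. F (w, a) \<partial>k w)"
      unfolding J_def by (rule integral_distr) (use w in auto)
  qed
  also have "\<dots> = (\<integral>\<omega>. (\<integral>a. F (W \<omega>, a) \<partial>k (W \<omega>)) \<partial>M)"
  proof -
    have "(\<lambda>w. \<integral>a. F (w, a) \<partial>k w) \<in> borel_measurable C"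
    proof -
      have "(\<lambda>w. \<integral>z. F z \<partial>J w) \<in> borel_measurable C"
        by (rule measurable_compose[OF J]) simp
      also have "?this \<longleftrightarrow> ?thesis"
      proof (rule measurable_cong)
        fix w assume w: "w \<in> space C"
        have [measurable_cong]: "sets (k w) = sets A" by (rule kw[OF w])
        show "(\<integral>z. F z \<partial>J w) = (\<integral>a. F (w, a) \<partial>k w)"
          unfolding J_def by (rule integral_distr) (use w in auto)
      qed
      finally show ?thesis .
    qed
    then show ?thesis unfolding D_def by (subst integral_distr) auto
  qed
  finally show ?thesis .
qed

text \<open>Integrand and measure both vary with \<open>w\<close>. Pushing \<open>k w\<close>
  forward to the product space leaves the fixed integrand \<open>F\<close> against a measurable
  kernel; the bound of \<open>F\<close> survives because \<open>k w\<close> has mass one.\<close>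

lemma kernel_integral_bounded_measurable:
  assumes k: "k \<in> measurable C (prob_algebra A)"
    and F: "F \<in> bounded_measurable (C \<Otimes>\<^sub>M A)"
  shows "(\<lambda>w. \<integral>a. F (w, a) \<partial>k w) \<in> bounded_measurable C"
proof -
  have F_meas[measurable]: "F \<in> borel_measurable (C \<Otimes>\<^sub>M A)" and "bounded (F ` space (C \<Otimes>\<^sub>M A))"
    using F by (auto simp: bounded_measurable_def)
  then obtain b where b: "\<And>z. z \<in> space (C \<Otimes>\<^sub>M A) \<Longrightarrow> \<bar>F z\<bar> \<le> b" by (auto simp: bounded_iff)
  have kw: "prob_space (k w)" "sets (k w) = sets A" "space (k w) = space A" if "w \<in> space C" for w
    using measurable_space[OF k that] by (auto simp: space_prob_algebra dest: sets_eq_imp_space_eq)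
  have ks[measurable]: "k \<in> measurable C (subprob_algebra A)"
    using k by (rule measurable_prob_algebraD)
  have "(\<lambda>w. \<integral>z. F z \<partial>distr (k w) (C \<Otimes>\<^sub>M A) (\<lambda>a. (w, a))) \<in> borel_measurable C"
    by (rule measurable_compose[OF measurable_distr2[OF _ ks]]) simp_all
  also have "?this \<longleftrightarrow> (\<lambda>w. \<integral>a. F (w, a) \<partial>k w) \<in> borel_measurable C"
  proof (rule measurable_cong)
    fix w assume w: "w \<in> space C"
    have [measurable_cong]: "sets (k w) = sets A" by (rule kw[OF w])
    show "(\<integral>z. F z \<partial>distr (k w) (C \<Otimes>\<^sub>M A) (\<lambda>a. (w, a))) = (\<integral>a. F (w, a) \<partial>k w)"
      by (rule integral_distr) (use w in auto)
  qed
  finally have "(\<lambda>w. \<integral>a. F (w, a) \<partial>k w) \<in> borel_measurable C" .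
  moreover have "\<bar>\<integral>a. F (w, a) \<partial>k w\<bar> \<le> b" if w: "w \<in> space C" for w
  proof -
    interpret k: prob_space "k w" by (rule kw[OF w])
    have [measurable_cong]: "sets (k w) = sets A" by (rule kw[OF w])
    have int: "integrable (k w) (\<lambda>a. F (w, a))"
      by (rule k.integrable_const_bound[where B=b]) (use w kw b in \<open>auto simp: space_pair_measure\<close>)
    have "\<bar>\<integral>a. F (w, a) \<partial>k w\<bar> \<le> (\<integral>a. \<bar>F (w, a)\<bar> \<partial>k w)" by (rule integral_abs_bound)
    also have "\<dots> \<le> b"
      by (rule k.integral_le_const) (use int w kw b in \<open>auto simp: space_pair_measure\<close>)
    finally show ?thesis .
  qed
  ultimately show ?thesis by (auto simp: bounded_measurable_def bounded_iff)
qed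

section \<open>Histories, appended coordinates and conditional laws\<close>

lemma proj_measurable: "t \<le> N \<Longrightarrow> proj t \<in> measurable (hist X N) (hist X t)"
  unfolding proj_def hist_def by (rule measurable_restrict_subset) auto

lemma component_measurable: "t \<in> {1..N} \<Longrightarrow> (\<lambda>x. x t) \<in> measurable (hist X N) (borel_of (X t))"
  unfolding hist_def by (rule measurable_component_singleton)

lemma proj_Suc: "proj (Suc t) x = (proj t x)(Suc t := x (Suc t))"
  by (auto simp: proj_def fun_eq_iff)

lemma append_measurable:
  "(\<lambda>(u, a). u(Suc t := a)) \<in> measurable (hist X t \<Otimes>\<^sub>M borel_of (X (Suc t))) (hist X (Suc t))"
proof -
  have "{1..Suc t} = insert (Suc t) {1..t}" by auto
  then show ?thesis unfolding hist_def by (simp only:) (rule measurable_add_dim[of "Suc t" "{1..t}" "\<lambda>i. borel_of (X i)"])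
qed

lemma bounded_measurable_compose:
  assumes "f \<in> bounded_measurable B" "h \<in> measurable A B"
  shows "(\<lambda>x. f (h x)) \<in> bounded_measurable A"
  using assms measurable_space[OF assms(2)] by (auto simp: bounded_measurable_def bounded_iff)

text \<open>The kernel sees only the first history, while \<open>v\<close> is a parameter. This
  keeps the integrations of the recursion within the bounded measurable functions.\<close>

lemma append_kernel_bounded_measurable:
  assumes k: "k \<in> measurable (hist X t) (prob_algebra (borel_of (X (Suc t))))"
    and h: "h \<in> bounded_measurable (hist X (Suc t) \<Otimes>\<^sub>M B)"
  shows "(\<lambda>(u, v). \<integral>a. h (u(Suc t := a), v) \<partial>k u) \<in> bounded_measurable (hist X t \<Otimes>\<^sub>M B)"
proof -
  note [measurable] = append_measurable
  have [measurable]: "(\<lambda>w. k (fst w)) \<in> measurable (hist X t \<Otimes>\<^sub>M B) (prob_algebra (borel_of (X (Suc t))))"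
    using k by measurable
  have m: "(\<lambda>(w, a). ((\<lambda>(u, a). u(Suc t := a)) (fst w, a), snd w)) \<in>
      measurable ((hist X t \<Otimes>\<^sub>M B) \<Otimes>\<^sub>M borel_of (X (Suc t))) (hist X (Suc t) \<Otimes>\<^sub>M B)"
    by measurable
  have "(\<lambda>w. \<integral>a. h ((fst w)(Suc t := a), snd w) \<partial>k (fst w)) \<in> bounded_measurable (hist X t \<Otimes>\<^sub>M B)"
    using kernel_integral_bounded_measurable[OF _ bounded_measurable_compose[OF h m], of "\<lambda>w. k (fst w)"]
    by simp
  then show ?thesis by (simp add: case_prod_unfold)
qed

lemma regular_cond_lawsD:
  assumes "regular_cond_laws X N \<mu> \<kappa>" "t \<in> {1..<N}"
  shows "\<kappa> (Suc t) \<in> measurable (hist X t) (prob_algebra (borel_of (X (Suc t))))"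
    and "B \<in> sets (borel_of (X (Suc t))) \<Longrightarrow> AE x in \<mu>. measure (\<kappa> (Suc t) (proj t x)) B =
             real_cond_exp \<mu> (vimage_algebra (space \<mu>) (proj t) (hist X t))
               (\<lambda>x. indicator B (x (Suc t))) x"
  using assms unfolding regular_cond_laws_def by auto

lemma finite_measure_subalgebra_vimage:
  assumes "prob_space M" "W \<in> measurable M C"
  shows "finite_measure_subalgebra M (vimage_algebra (space M) W C)"
proof -
  interpret prob_space M by fact
  have "subalgebra M (vimage_algebra (space M) W C)"
    using assms(2) measurable_space[OF assms(2)]
    by (auto simp: subalgebra_def sets_vimage_algebra2 intro: measurable_sets)
  then show ?thesis by unfold_locales
qed

lemma prob_kernel:
  assumes "k \<in> measurable C (prob_algebra A)" "w \<in> space C"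
  shows "prob_space (k w)" "sets (k w) = sets A" "space (k w) = space A"
  using measurable_space[OF assms] by (auto simp: space_prob_algebra dest: sets_eq_imp_space_eq)

text \<open>The indicator of \<open>c\<close> at the history is measurable for the \<sigma>-algebra
  of the first \<open>t\<close> coordinates, so the conditional expectation can be tested against
  it, and the kernel is a version of that expectation.\<close>

lemma cond_law_rectangle:
  assumes \<mu>: "\<mu> \<in> space (prob_algebra (hist X N))" and reg: "regular_cond_laws X N \<mu> \<kappa>"
    and t: "t \<in> {1..<N}" and c[measurable]: "c \<in> sets (hist X t)" and a[measurable]: "a \<in> sets (borel_of (X (Suc t)))"
  shows "(\<integral>x. indicator c (proj t x) * indicator a (x (Suc t)) \<partial>\<mu>) =
    (\<integral>x. indicator c (proj t x) * measure (\<kappa> (Suc t) (proj t x)) a \<partial>\<mu>)"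
proof -
  have pr: "prob_space \<mu>" and [measurable_cong]: "sets \<mu> = sets (hist X N)"
    using \<mu> by (auto simp: space_prob_algebra)
  interpret prob_space \<mu> by fact
  note [measurable] = regular_cond_lawsD(1)[OF reg t]
  have p[measurable]: "proj t \<in> measurable \<mu> (hist X t)"
    using proj_measurable[of t N X] t by (auto cong: measurable_cong_sets)
  have [measurable]: "(\<lambda>x. x (Suc t)) \<in> measurable \<mu> (borel_of (X (Suc t)))"
    using component_measurable[of "Suc t" N X] t by (auto cong: measurable_cong_sets)
  let ?F = "vimage_algebra (space \<mu>) (proj t) (hist X t)"
  interpret finite_measure_subalgebra \<mu> ?F
    by (rule finite_measure_subalgebra_vimage) (use pr p in auto)
  have "proj t \<in> measurable ?F (hist X t)"
    by (rule measurable_vimage_algebra1) (use measurable_space[OF p] in auto)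
  then have f: "(\<lambda>x. indicator c (proj t x) :: real) \<in> borel_measurable ?F"
    by measurable
  have "(\<integral>x. indicator c (proj t x) * indicator a (x (Suc t)) \<partial>\<mu>) =
      (\<integral>x. indicator c (proj t x) * real_cond_exp \<mu> ?F (\<lambda>x. indicator a (x (Suc t))) x \<partial>\<mu>)"
  proof (rule real_cond_exp_intg(2)[OF _ f, symmetric])
    show "integrable \<mu> (\<lambda>x. indicator c (proj t x) * indicator a (x (Suc t)) :: real)"
      by (rule integrable_const_bound[where B=1]) (auto simp: indicator_def)
  qed measurable
  also have "\<dots> = (\<integral>x. indicator c (proj t x) * measure (\<kappa> (Suc t) (proj t x)) a \<partial>\<mu>)"
  proof (rule integral_cong_AE)
    show "AE x in \<mu>. indicator c (proj t x) * real_cond_exp \<mu> ?F (\<lambda>x. indicator a (x (Suc t))) x =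
        indicator c (proj t x) * measure (\<kappa> (Suc t) (proj t x)) a"
      using regular_cond_lawsD(2)[OF reg t a] by (rule eventually_mono) simp
  qed measurable
  finally show ?thesis .
qed

lemma cond_law_integral:
  assumes \<mu>: "\<mu> \<in> space (prob_algebra (hist X N))" and reg: "regular_cond_laws X N \<mu> \<kappa>"
    and t: "t \<in> {1..<N}" and F: "F \<in> bounded_measurable (hist X (Suc t))"
  shows "(\<integral>x. F (proj (Suc t) x) \<partial>\<mu>) = (\<integral>x. (\<integral>a. F ((proj t x)(Suc t := a)) \<partial>\<kappa> (Suc t) (proj t x)) \<partial>\<mu>)"
proof -
  have pr: "prob_space \<mu>" and s: "sets \<mu> = sets (hist X N)"
    using \<mu> by (auto simp: space_prob_algebra)
  have p: "proj t \<in> measurable \<mu> (hist X t)"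
    using proj_measurable[of t N X] t s by (auto cong: measurable_cong_sets)
  have c: "(\<lambda>x. x (Suc t)) \<in> measurable \<mu> (borel_of (X (Suc t)))"
    using component_measurable[of "Suc t" N X] t s by (auto cong: measurable_cong_sets)
  let ?F = "\<lambda>z. F ((\<lambda>(u, a). u(Suc t := a)) z)"
  have "?F \<in> bounded_measurable (hist X t \<Otimes>\<^sub>M borel_of (X (Suc t)))"
    by (rule bounded_measurable_compose[OF F append_measurable])
  then have F': "?F \<in> borel_measurable (hist X t \<Otimes>\<^sub>M borel_of (X (Suc t)))"
      "bounded (?F ` space (hist X t \<Otimes>\<^sub>M borel_of (X (Suc t))))"
    unfolding bounded_measurable_def by auto
  from disintegration_rectangles[OF pr p c regular_cond_lawsD(1)[OF reg t] cond_law_rectangle[OF \<mu> reg t] F']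
  show ?thesis unfolding proj_Suc prod.case .
qed

text \<open>Weighting \<open>M\<close> by \<open>p\<close> or \<open>q\<close> and pushing it
  forward along \<open>(W, V)\<close> gives two finite measures that agree on rectangles. This
  extends the product events of conditional independence to all events of a pair of histories, as
  \<open>disintegration_rectangles\<close> requires.\<close>

lemma integral_eq_pair_rectangles:
  fixes p q :: "'w \<Rightarrow> real"
  assumes M: "prob_space M" and [measurable]: "W \<in> measurable M C" "V \<in> measurable M D"
    and [measurable]: "p \<in> borel_measurable M" "q \<in> borel_measurable M"
    and p: "\<And>x. x \<in> space M \<Longrightarrow> 0 \<le> p x \<and> p x \<le> 1" and q: "\<And>x. x \<in> space M \<Longrightarrow> 0 \<le> q x \<and> q x \<le> 1"
    and eq: "\<And>c d. c \<in> sets C \<Longrightarrow> d \<in> sets D \<Longrightarrow>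
      (\<integral>x. indicator c (W x) * indicator d (V x) * p x \<partial>M) = (\<integral>x. indicator c (W x) * indicator d (V x) * q x \<partial>M)"
    and e: "e \<in> sets (C \<Otimes>\<^sub>M D)"
  shows "(\<integral>x. indicator e (W x, V x) * p x \<partial>M) = (\<integral>x. indicator e (W x, V x) * q x \<partial>M)"
proof -
  interpret prob_space M by fact
  define m where "m r = distr (density M (\<lambda>x. ennreal (r x))) (C \<Otimes>\<^sub>M D) (\<lambda>x. (W x, V x))" for r :: "'w \<Rightarrow> real"
  have em: "emeasure (m r) e = ennreal (\<integral>x. indicator e (W x, V x) * r x \<partial>M)"
    if [measurable]: "e \<in> sets (C \<Otimes>\<^sub>M D)" "r \<in> borel_measurable M" and r: "\<And>x. x \<in> space M \<Longrightarrow> 0 \<le> r x \<and> r x \<le> 1" for r e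
  proof -
    have "emeasure (m r) e = (\<integral>\<^sup>+x. ennreal (r x) * indicator ((\<lambda>x. (W x, V x)) -` e \<inter> space M) x \<partial>M)"
      unfolding m_def by (subst emeasure_distr) (auto simp: emeasure_density)
    also have "\<dots> = (\<integral>\<^sup>+x. ennreal (indicator e (W x, V x) * r x) \<partial>M)"
      by (rule nn_integral_cong) (auto simp: indicator_def)
    also have "\<dots> = ennreal (\<integral>x. indicator e (W x, V x) * r x \<partial>M)"
    proof (rule nn_integral_eq_integral)
      show "integrable M (\<lambda>x. indicator e (W x, V x) * r x)"
        by (rule integrable_const_bound[where B=1]) (use r in \<open>auto simp: indicator_def\<close>)
    qed (use r in auto)
    finally show ?thesis .
  qed
  have "m p = m q"
  proof (rule measure_eqI_rectangles[of _ C D])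
    have "emeasure (m p) (space (m p)) \<noteq> \<infinity>"
      using em[OF _ _ p, of "space (C \<Otimes>\<^sub>M D)"] by (simp add: m_def)
    then show "finite_measure (m p)" by (rule finite_measureI)
    fix c d assume [measurable]: "c \<in> sets C" "d \<in> sets D"
    have *: "indicator (c \<times> d) (W x, V x) = (indicator c (W x) * indicator d (V x) :: real)" for x
      by (simp add: indicator_def)
    show "emeasure (m p) (c \<times> d) = emeasure (m q) (c \<times> d)"
      using eq[of c d] by (simp add: em p q *)
  qed (auto simp: m_def)
  then have "emeasure (m p) e = emeasure (m q) e" by simp
  moreover have "0 \<le> (\<integral>x. indicator e (W x, V x) * p x \<partial>M)" "0 \<le> (\<integral>x. indicator e (W x, V x) * q x \<partial>M)"
    using p q by (auto intro!: Bochner_Integration.integral_nonneg)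
  ultimately show ?thesis using em[OF e _ p] em[OF e _ q] by simp
qed

lemma causal_plansD:
  assumes "\<rho> \<in> causal_plans X Y N \<mu>"
  shows "prob_space \<rho>" "sets \<rho> = sets (path_pair X Y N)" "distr \<rho> (hist X N) fst = \<mu>" "causal X Y N \<rho>"
  using assms by (auto simp: causal_plans_def space_prob_algebra)

text \<open>Causality lets the \<open>y\<close>-history join the conditioning without changing the
  law of \<open>x (Suc t)\<close>, so the kernel of \<mu> disintegrates \<rho> along the pair of
  histories.\<close>

lemma causal_integral:
  assumes \<mu>: "\<mu> \<in> space (prob_algebra (hist X N))" and reg: "regular_cond_laws X N \<mu> \<kappa>"
    and \<rho>: "\<rho> \<in> causal_plans X Y N \<mu>"
    and t: "t \<in> {1..<N}" and F: "F \<in> bounded_measurable (hist X (Suc t) \<Otimes>\<^sub>M hist Y t)"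
  shows "(\<integral>(x, y). F (proj (Suc t) x, proj t y) \<partial>\<rho>) =
    (\<integral>(x, y). (\<integral>a. F ((proj t x)(Suc t := a), proj t y) \<partial>\<kappa> (Suc t) (proj t x)) \<partial>\<rho>)"
proof -
  note s = causal_plansD(2)[OF \<rho>]
  have [measurable_cong]: "sets \<rho> = sets (hist X N \<Otimes>\<^sub>M hist Y N)" using s by (simp add: path_pair_def)
  interpret prob_space \<rho> by (rule causal_plansD[OF \<rho>])
  note [measurable] = regular_cond_lawsD(1)[OF reg t]
  have [measurable]: "proj t \<in> measurable (hist X N) (hist X t)" "proj t \<in> measurable (hist Y N) (hist Y t)"
    "(\<lambda>x. x (Suc t)) \<in> measurable (hist X N) (borel_of (X (Suc t)))"
    using t by (auto intro: proj_measurable component_measurable)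
  define W where "W = (\<lambda>(x :: nat \<Rightarrow> 'a, y :: nat \<Rightarrow> 'b). proj t x)"
  define V where "V = (\<lambda>(x :: nat \<Rightarrow> 'a, y :: nat \<Rightarrow> 'b). proj t y)"
  define U where "U = (\<lambda>(x :: nat \<Rightarrow> 'a, y :: nat \<Rightarrow> 'b). x (Suc t))"
  have W[measurable]: "W \<in> measurable \<rho> (hist X t)" unfolding W_def by measurable
  have V[measurable]: "V \<in> measurable \<rho> (hist Y t)" unfolding V_def by measurable
  have U[measurable]: "U \<in> measurable \<rho> (borel_of (X (Suc t)))" unfolding U_def by measurable
  let ?G = "vimage_algebra (space \<rho>) W (hist X t)"
  interpret finite_measure_subalgebra \<rho> ?G
    by (rule finite_measure_subalgebra_vimage) (use prob_space_axioms W in auto)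
  have WG[measurable]: "W \<in> measurable ?G (hist X t)"
    by (rule measurable_vimage_algebra1) (use measurable_space[OF W] in auto)
  have k1: "measure (\<kappa> (Suc t) w) a \<le> 1" if "w \<in> space (hist X t)" for w a
    using prob_kernel(1)[OF regular_cond_lawsD(1)[OF reg t] that] by (rule prob_space.prob_le_1)
  have Wsp: "W z \<in> space (hist X t)" if "z \<in> space \<rho>" for z
    using measurable_space[OF W that] .
  have marg: "(\<integral>(x, y). f x \<partial>\<rho>) = (\<integral>x. f x \<partial>\<mu>)" if [measurable]: "f \<in> borel_measurable (hist X N)" for f :: "_ \<Rightarrow> real"
    unfolding causal_plansD(3)[OF \<rho>, symmetric] by (subst integral_distr) (auto simp: case_prod_unfold)
  \<comment> \<open>Event and conditioning involve only the \<open>x\<close>-path, whose law under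
    \<rho> is \<mu>; the identity is moved to \<mu>, applied there and moved back.\<close>
  have ka: "AE z in \<rho>. real_cond_exp \<rho> ?G (\<lambda>z. indicator a (U z)) z = measure (\<kappa> (Suc t) (W z)) a"
    if a[measurable]: "a \<in> sets (borel_of (X (Suc t)))" for a
  proof (rule real_cond_exp_charact)
    fix A assume "A \<in> sets ?G"
    then obtain c where c[measurable]: "c \<in> sets (hist X t)" and A: "A = W -` c \<inter> space \<rho>"
      using Wsp by (auto simp: sets_vimage_algebra2)
    have "(\<integral>z\<in>A. indicator a (U z) \<partial>\<rho>) = (\<integral>(x, y). indicator c (proj t x) * indicator a (x (Suc t)) \<partial>\<rho> :: real)"
      unfolding set_lebesgue_integral_def A
      by (rule Bochner_Integration.integral_cong) (auto simp: W_def U_def indicator_def)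
    also have "\<dots> = (\<integral>x. indicator c (proj t x) * indicator a (x (Suc t)) \<partial>\<mu>)"
      by (rule marg) measurable
    also have "\<dots> = (\<integral>x. indicator c (proj t x) * measure (\<kappa> (Suc t) (proj t x)) a \<partial>\<mu>)"
      by (rule cond_law_rectangle[OF \<mu> reg t c a])
    also have "\<dots> = (\<integral>(x, y). indicator c (proj t x) * measure (\<kappa> (Suc t) (proj t x)) a \<partial>\<rho>)"
      by (rule marg[symmetric]) measurable
    also have "\<dots> = (\<integral>z\<in>A. measure (\<kappa> (Suc t) (W z)) a \<partial>\<rho>)"
      unfolding set_lebesgue_integral_def A
      by (rule Bochner_Integration.integral_cong) (auto simp: W_def U_def indicator_def)
    finally show "(\<integral>z\<in>A. indicator a (U z) \<partial>\<rho>) = (\<integral>z\<in>A. measure (\<kappa> (Suc t) (W z)) a \<partial>\<rho>)" .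
  next
    show "integrable \<rho> (\<lambda>z. indicator a (U z) :: real)"
      by (rule integrable_const_bound[where B=1]) (auto simp: indicator_def)
    show "integrable \<rho> (\<lambda>z. measure (\<kappa> (Suc t) (W z)) a)"
      by (rule integrable_const_bound[where B=1]) (use k1 Wsp in auto)
  qed measurable
  \<comment> \<open>Conditional independence splits the conditional expectation of the product. The
    kernel factor depends on \<open>W\<close> alone, so the conditional expectation of the
    \<open>d\<close>-factor can be undone against it.\<close>
  have rect: "(\<integral>z. indicator c (W z) * indicator d (V z) * indicator a (U z) \<partial>\<rho>) =
      (\<integral>z. indicator c (W z) * indicator d (V z) * measure (\<kappa> (Suc t) (W z)) a \<partial>\<rho>)"
    if c[measurable]: "c \<in> sets (hist X t)" and d[measurable]: "d \<in> sets (hist Y t)"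
      and a[measurable]: "a \<in> sets (borel_of (X (Suc t)))" for c d a
  proof -
    have ci: "AE z in \<rho>. real_cond_exp \<rho> ?G (\<lambda>z. indicator a (U z) * indicator d (V z)) z =
        real_cond_exp \<rho> ?G (\<lambda>z. indicator a (U z)) z * real_cond_exp \<rho> ?G (\<lambda>z. indicator d (V z)) z"
      using causal_plansD(4)[OF \<rho>] t a d
      unfolding causal_def cond_indep_var_def Let_def W_def V_def U_def by blast
    have "(\<integral>z. indicator c (W z) * indicator d (V z) * indicator a (U z) \<partial>\<rho> :: real) =
        (\<integral>z. indicator c (W z) * (indicator a (U z) * indicator d (V z)) \<partial>\<rho>)"
      by (simp add: mult_ac)
    also have "\<dots> = (\<integral>z. indicator c (W z) * real_cond_exp \<rho> ?G (\<lambda>z. indicator a (U z) * indicator d (V z)) z \<partial>\<rho>)"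
    proof (rule real_cond_exp_intg(2)[symmetric])
      show "integrable \<rho> (\<lambda>z. indicator c (W z) * (indicator a (U z) * indicator d (V z)) :: real)"
        by (rule integrable_const_bound[where B=1]) (auto simp: indicator_def)
    qed measurable
    also have "\<dots> = (\<integral>z. (indicator c (W z) * measure (\<kappa> (Suc t) (W z)) a) * real_cond_exp \<rho> ?G (\<lambda>z. indicator d (V z)) z \<partial>\<rho>)"
    proof (rule integral_cong_AE)
      show "AE z in \<rho>. indicator c (W z) * real_cond_exp \<rho> ?G (\<lambda>z. indicator a (U z) * indicator d (V z)) z =
        (indicator c (W z) * measure (\<kappa> (Suc t) (W z)) a) * real_cond_exp \<rho> ?G (\<lambda>z. indicator d (V z)) z"
        using ci ka[OF a] by eventually_elim simp
    qed measurable
    also have "\<dots> = (\<integral>z. (indicator c (W z) * measure (\<kappa> (Suc t) (W z)) a) * indicator d (V z) \<partial>\<rho>)"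
    proof (rule real_cond_exp_intg(2))
      show "integrable \<rho> (\<lambda>z. (indicator c (W z) * measure (\<kappa> (Suc t) (W z)) a) * indicator d (V z))"
        by (rule integrable_const_bound[where B=1]) (use k1 Wsp in \<open>auto simp: indicator_def\<close>)
    qed measurable
    finally show ?thesis by (simp add: mult_ac)
  qed
  have ev: "(\<integral>z. indicator e (W z, V z) * indicator a (U z) \<partial>\<rho>) =
      (\<integral>z. indicator e (W z, V z) * measure (\<kappa> (Suc t) (fst (W z, V z))) a \<partial>\<rho>)"
    if e: "e \<in> sets (hist X t \<Otimes>\<^sub>M hist Y t)" and a[measurable]: "a \<in> sets (borel_of (X (Suc t)))" for e a
  proof -
    have "(\<integral>z. indicator e (W z, V z) * indicator a (U z) \<partial>\<rho>) =
      (\<integral>z. indicator e (W z, V z) * measure (\<kappa> (Suc t) (W z)) a \<partial>\<rho>)"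
      by (rule integral_eq_pair_rectangles[OF prob_space_axioms W V _ _ _ _ rect[OF _ _ a] e])
        (use k1 Wsp in \<open>auto simp: indicator_def\<close>)
    then show ?thesis by simp
  qed
  note [measurable] = append_measurable
  have m: "(\<lambda>(w, a). ((\<lambda>(u, a). u(Suc t := a)) (fst w, a), snd w)) \<in>
      measurable ((hist X t \<Otimes>\<^sub>M hist Y t) \<Otimes>\<^sub>M borel_of (X (Suc t))) (hist X (Suc t) \<Otimes>\<^sub>M hist Y t)"
    by measurable
  have WV: "(\<lambda>z. (W z, V z)) \<in> measurable \<rho> (hist X t \<Otimes>\<^sub>M hist Y t)" by measurable
  have k: "(\<lambda>w. \<kappa> (Suc t) (fst w)) \<in> measurable (hist X t \<Otimes>\<^sub>M hist Y t) (prob_algebra (borel_of (X (Suc t))))"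
    by measurable
  \<comment> \<open>The new coordinate is split off from the \<open>x\<close>-history, which makes
    \<open>F\<close> a function of the conditioning pair and of \<open>U\<close>.\<close>
  let ?F = "\<lambda>z. F ((\<lambda>(w, a). ((\<lambda>(u, a). u(Suc t := a)) (fst w, a), snd w)) z)"
  have "?F \<in> bounded_measurable ((hist X t \<Otimes>\<^sub>M hist Y t) \<Otimes>\<^sub>M borel_of (X (Suc t)))"
    by (rule bounded_measurable_compose[OF F m])
  then have F': "?F \<in> borel_measurable ((hist X t \<Otimes>\<^sub>M hist Y t) \<Otimes>\<^sub>M borel_of (X (Suc t)))"
      "bounded (?F ` space ((hist X t \<Otimes>\<^sub>M hist Y t) \<Otimes>\<^sub>M borel_of (X (Suc t))))"
    unfolding bounded_measurable_def by auto
  from disintegration_rectangles[OF prob_space_axioms WV U k ev F']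
  show ?thesis unfolding proj_Suc W_def V_def U_def case_prod_unfold fst_conv snd_conv .
qed

section \<open>Kullback-Leibler divergence\<close>

text \<open>
  With \<open>q\<close> the density of \<open>\<rho>\<close> and \<open>exp s\<close> the density of \<open>\<pi>\<close>, integrating this tangent bound gives
  \<open>D(\<rho>, \<gamma>) \<ge> \<integral> s d\<rho>\<close>; taking \<open>s = 0\<close> bounds the negative part of the logarithm.
\<close>

lemma entropy_tangent:
  fixes q s :: real
  assumes "0 \<le> q"
  shows "q * s + q - exp s \<le> q * ln q"
    and "q * ln q = q * s + q - exp s \<Longrightarrow> q = exp s"
proof -
  have "q * s + q - exp s \<le> q * ln q \<and> (q * ln q = q * s + q - exp s \<longrightarrow> q = exp s)"
  proof (cases "q = 0")
    case False
    \<comment> \<open>The ratio turns the bound into \<open>ln r \<le> r - 1\<close>, whose equality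
      case is \<open>r = 1\<close>. For \<open>q = 0\<close> the smaller side is
      \<open>- exp s\<close>, which is negative, so equality cannot occur.\<close>
    define r where "r = exp s / q"
    have r: "r > 0" "exp s = q * r" "ln r = s - ln q" using False assms by (auto simp: r_def ln_div)
    have "q * ln r \<le> q * (r - 1)" using ln_le_minus_one[OF r(1)] assms by (rule mult_left_mono)
    moreover have "r = 1" if "q * ln r = q * (r - 1)"
      using that ln_eq_minus_one[OF r(1)] False by auto
    ultimately show ?thesis using r(2,3) by (auto simp: algebra_simps)
  qed auto
  then show "q * s + q - exp s \<le> q * ln q" "q * ln q = q * s + q - exp s \<Longrightarrow> q = exp s" by auto
qed

lemma ext_integral_eq_integral:
  assumes "integrable M f"
  shows "ext_integral M f = ereal (\<integral>x. f x \<partial>M)"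
proof -
  have fin: "(\<integral>\<^sup>+x. ennreal (f x) \<partial>M) \<noteq> \<infinity>" "(\<integral>\<^sup>+x. ennreal (- f x) \<partial>M) \<noteq> \<infinity>"
    using assms by (auto simp: real_integrable_def)
  then show ?thesis
    unfolding ext_integral_def real_lebesgue_integral_def[OF assms]
    by (cases "\<integral>\<^sup>+x. ennreal (f x) \<partial>M"; cases "\<integral>\<^sup>+x. ennreal (- f x) \<partial>M") (auto simp: enn2ereal_ennreal)
qed

text \<open>A finite negative part excludes the form \<infinity> - \<infinity>, so an infinite
  positive part would make the extended integral infinite.\<close>

lemma integrable_if_ext_integral:
  assumes "f \<in> borel_measurable M" "(\<integral>\<^sup>+x. ennreal (- f x) \<partial>M) \<noteq> \<infinity>" "ext_integral M f \<noteq> \<infinity>"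
  shows "integrable M f"
proof -
  have "(\<integral>\<^sup>+x. ennreal (f x) \<partial>M) \<noteq> \<infinity>"
    using assms(2,3) unfolding ext_integral_def
    by (cases "\<integral>\<^sup>+x. ennreal (- f x) \<partial>M") (auto simp: enn2ereal_ennreal)
  with assms(1,2) show ?thesis by (simp add: real_integrable_def)
qed

text \<open>The Radon-Nikodym derivative is determined only \<gamma>-almost everywhere; as \<pi> has
  a density, its identification with \<open>exp s\<close> passes to \<pi>, where the logarithm is
  integrated.\<close>

lemma D_KL_exp_density:
  assumes [measurable]: "s \<in> borel_measurable \<gamma>" and \<gamma>: "sigma_finite_measure \<gamma>"
    and \<pi>: "\<pi> = density \<gamma> (\<lambda>z. ennreal (exp (s z)))" and int: "integrable \<pi> s"
  shows "D_KL \<pi> \<gamma> = ereal (\<integral>z. s z \<partial>\<pi>)"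
proof -
  interpret sigma_finite_measure \<gamma> by fact
  have ac: "absolutely_continuous \<gamma> \<pi>" unfolding \<pi> by (rule absolutely_continuousI_density) simp
  have "AE z in \<gamma>. ennreal (exp (s z)) = RN_deriv \<gamma> \<pi> z"
    by (rule RN_deriv_unique) (auto simp: \<pi>)
  then have "AE z in \<gamma>. ln (enn2real (RN_deriv \<gamma> \<pi> z)) = s z"
  proof (rule eventually_mono)
    fix z assume "ennreal (exp (s z)) = RN_deriv \<gamma> \<pi> z"
    from this[symmetric] show "ln (enn2real (RN_deriv \<gamma> \<pi> z)) = s z" by (simp add: enn2real_ennreal)
  qed
  then have "AE z in \<pi>. ln (enn2real (RN_deriv \<gamma> \<pi> z)) = s z"
    unfolding \<pi> by (subst AE_density) auto
  then have "ext_integral \<pi> (\<lambda>z. ln (enn2real (RN_deriv \<gamma> \<pi> z))) = ext_integral \<pi> s"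
    unfolding ext_integral_def by (intro arg_cong2[where f="(-)"] arg_cong[where f=enn2ereal] nn_integral_cong_AE) auto
  with ac int show ?thesis by (simp add: D_KL_def ext_integral_eq_integral)
qed

lemma prob_density_integral:
  fixes q :: "'w \<Rightarrow> real"
  assumes [measurable]: "q \<in> borel_measurable M" and q: "\<And>z. 0 \<le> q z"
    and p: "prob_space (density M (\<lambda>z. ennreal (q z)))"
  shows "integrable M q" and "(\<integral>z. q z \<partial>M) = 1"
proof -
  have "(\<integral>\<^sup>+z. ennreal (q z) \<partial>M) = emeasure (density M (\<lambda>z. ennreal (q z))) (space M)"
    by (subst emeasure_density) (auto intro!: nn_integral_cong)
  also have "\<dots> = ennreal 1"
    using prob_space.emeasure_space_1[OF p] by simp
  finally have "has_bochner_integral M q 1"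
    by (intro has_bochner_integral_nn_integral) (auto simp: q)
  then show "integrable M q" "(\<integral>z. q z \<partial>M) = 1" by (auto simp: has_bochner_integral_iff)
qed

text \<open>Both densities have mass one, so \<open>q - exp s\<close> has integral zero and the gap
  in the tangent bound integrates to \<open>D_KL \<rho> \<gamma>\<close> minus the integral of
  \<open>s\<close> under \<rho>. A nonnegative gap with zero integral vanishes almost everywhere,
  which identifies the densities.\<close>

lemma D_KL_lower_bound:
  assumes [measurable]: "s \<in> borel_measurable \<gamma>" and \<gamma>: "prob_space \<gamma>"
    and \<pi>: "prob_space \<pi>" "\<pi> = density \<gamma> (\<lambda>z. ennreal (exp (s z)))"
    and \<rho>: "prob_space \<rho>" "sets \<rho> = sets \<gamma>" "integrable \<rho> s"
  shows "ereal (\<integral>z. s z \<partial>\<rho>) \<le> D_KL \<rho> \<gamma>"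
    and "D_KL \<rho> \<gamma> = ereal (\<integral>z. s z \<partial>\<rho>) \<Longrightarrow> \<rho> = \<pi>"
proof -
  have "ereal (\<integral>z. s z \<partial>\<rho>) \<le> D_KL \<rho> \<gamma> \<and> (D_KL \<rho> \<gamma> = ereal (\<integral>z. s z \<partial>\<rho>) \<longrightarrow> \<rho> = \<pi>)"
  proof (cases "D_KL \<rho> \<gamma> = \<infinity>")
    case False
    interpret \<gamma>: prob_space \<gamma> by fact
    interpret \<rho>: prob_space \<rho> by fact
    have ac: "absolutely_continuous \<gamma> \<rho>" using False by (auto simp: D_KL_def split: if_splits)
    define q where "q = (\<lambda>z. enn2real (RN_deriv \<gamma> \<rho> z))"
    have q[measurable]: "q \<in> borel_measurable \<gamma>" and q0: "\<And>z. 0 \<le> q z" by (auto simp: q_def)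
    have "AE z in \<gamma>. RN_deriv \<gamma> \<rho> z \<noteq> \<infinity>"
      by (rule \<gamma>.RN_deriv_finite) (use ac \<rho> \<rho>.sigma_finite_measure_axioms in auto)
    then have "density \<gamma> (\<lambda>z. ennreal (q z)) = density \<gamma> (RN_deriv \<gamma> \<rho>)"
      by (intro density_cong) (auto elim!: eventually_mono simp: q_def less_top)
    also have "\<dots> = \<rho>" using ac \<rho>(2) by (rule \<gamma>.density_RN_deriv)
    finally have dens: "\<rho> = density \<gamma> (\<lambda>z. ennreal (q z))" by simp
    have mr[measurable_cong]: "sets \<rho> = sets \<gamma>" by fact
    have KL: "D_KL \<rho> \<gamma> = ext_integral \<rho> (\<lambda>z. ln (q z))" using ac by (simp add: D_KL_def q_def)
    have "(\<integral>\<^sup>+z. ennreal (- ln (q z)) \<partial>\<rho>) = (\<integral>\<^sup>+z. ennreal (q z) * ennreal (- ln (q z)) \<partial>\<gamma>)"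
      by (subst dens, subst nn_integral_density) auto
    also have "\<dots> \<le> (\<integral>\<^sup>+z. 1 \<partial>\<gamma>)"
    proof (rule nn_integral_mono)
      fix z
      have "- (q z * ln (q z)) \<le> 1" using entropy_tangent(1)[OF q0[of z], of 0] q0[of z] by simp
      then show "ennreal (q z) * ennreal (- ln (q z)) \<le> 1"
        using q0[of z] by (simp add: ennreal_mult'[symmetric])
    qed
    also have "\<dots> = 1" by (simp add: \<gamma>.emeasure_space_1)
    finally have neg: "(\<integral>\<^sup>+z. ennreal (- ln (q z)) \<partial>\<rho>) \<noteq> \<infinity>" by (auto simp: top_unique)
    have ln_int: "integrable \<rho> (\<lambda>z. ln (q z))"
      by (rule integrable_if_ext_integral) (use neg False KL in auto)
    have KL': "D_KL \<rho> \<gamma> = ereal (\<integral>z. ln (q z) \<partial>\<rho>)" by (simp add: KL ext_integral_eq_integral[OF ln_int])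
    have i1: "integrable \<gamma> (\<lambda>z. q z * ln (q z))" "(\<integral>z. ln (q z) \<partial>\<rho>) = (\<integral>z. q z * ln (q z) \<partial>\<gamma>)"
      using ln_int q0 unfolding dens by (auto simp: integrable_density integral_density)
    have i2: "integrable \<gamma> (\<lambda>z. q z * s z)" "(\<integral>z. s z \<partial>\<rho>) = (\<integral>z. q z * s z \<partial>\<gamma>)"
      using \<rho>(3) q0 unfolding dens by (auto simp: integrable_density integral_density)
    have i3: "integrable \<gamma> q" "(\<integral>z. q z \<partial>\<gamma>) = 1"
      using prob_density_integral[of q \<gamma>] \<rho>(1) q0 dens by auto
    have i4: "integrable \<gamma> (\<lambda>z. exp (s z))" "(\<integral>z. exp (s z) \<partial>\<gamma>) = 1"
      using prob_density_integral[of "\<lambda>z. exp (s z)" \<gamma>] \<pi> by auto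
    let ?d = "\<lambda>z. q z * ln (q z) - q z * s z - q z + exp (s z)"
    have d0: "0 \<le> ?d z" for z using entropy_tangent(1)[OF q0[of z], of "s z"] by simp
    have id: "integrable \<gamma> ?d" using i1 i2 i3 i4 by auto
    have d: "(\<integral>z. ?d z \<partial>\<gamma>) = (\<integral>z. ln (q z) \<partial>\<rho>) - (\<integral>z. s z \<partial>\<rho>)"
      using i1 i2 i3 i4 by simp
    have "0 \<le> (\<integral>z. ?d z \<partial>\<gamma>)" using d0 by simp
    then have "ereal (\<integral>z. s z \<partial>\<rho>) \<le> D_KL \<rho> \<gamma>" unfolding KL' d by simp
    moreover have "\<rho> = \<pi>" if "D_KL \<rho> \<gamma> = ereal (\<integral>z. s z \<partial>\<rho>)"
    proof -
      have "(\<integral>z. ?d z \<partial>\<gamma>) = 0" using that unfolding KL' d by simp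
      then have "AE z in \<gamma>. ?d z = 0" using integral_nonneg_eq_0_iff_AE[OF id] d0 by auto
      then have "AE z in \<gamma>. q z = exp (s z)"
        by (rule eventually_mono) (auto intro!: entropy_tangent(2) q0)
      then show ?thesis unfolding dens \<pi>(2) by (intro density_cong) auto
    qed
    ultimately show ?thesis by simp
  qed auto
  then show "ereal (\<integral>z. s z \<partial>\<rho>) \<le> D_KL \<rho> \<gamma>" "D_KL \<rho> \<gamma> = ereal (\<integral>z. s z \<partial>\<rho>) \<Longrightarrow> \<rho> = \<pi>" by auto
qed

section \<open>Cylinder functions\<close>

text \<open>Two bounded functions take values in a compact rectangle, on which \<phi> is bounded.
  Two arguments cover sums and products; unary operations ignore the second one.\<close>

lemma bounded_measurable_continuous:
  fixes \<phi> :: "real \<times> real \<Rightarrow> real"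
  assumes \<phi>: "continuous_on UNIV \<phi>" and f: "f \<in> bounded_measurable M" and g: "g \<in> bounded_measurable M"
  shows "(\<lambda>z. \<phi> (f z, g z)) \<in> bounded_measurable M"
proof -
  obtain a b where ab: "\<And>z. z \<in> space M \<Longrightarrow> \<bar>f z\<bar> \<le> a" "\<And>z. z \<in> space M \<Longrightarrow> \<bar>g z\<bar> \<le> b"
    using f g by (auto simp: bounded_measurable_def bounded_iff)
  have [measurable]: "f \<in> borel_measurable M" "g \<in> borel_measurable M" "\<phi> \<in> borel_measurable borel"
    using f g borel_measurable_continuous_onI[OF \<phi>] by (auto simp: bounded_measurable_def)
  have "compact (\<phi> ` ({-a..a} \<times> {-b..b}))"
    by (intro compact_continuous_image compact_Times compact_Icc continuous_on_subset[OF \<phi>]) auto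
  then have "bounded (\<phi> ` ({-a..a} \<times> {-b..b}))" by (rule compact_imp_bounded)
  then have "bounded ((\<lambda>z. \<phi> (f z, g z)) ` space M)"
    by (rule bounded_subset) (use ab in \<open>force simp: abs_le_iff\<close>)
  then show ?thesis by (simp add: bounded_measurable_def)
qed

text \<open>
  Functions of \<open>(x\<^sub>1\<^sub>:\<^sub>s, y\<^sub>1\<^sub>:\<^sub>t)\<close> are kept as functions on the whole path space, so that functions of
  histories of different lengths can be added and multiplied.
\<close>

definition cylinder :: "(nat \<Rightarrow> 'a topology) \<Rightarrow> (nat \<Rightarrow> 'b topology) \<Rightarrow> nat \<Rightarrow> nat \<Rightarrow> nat \<Rightarrow>
    ((nat \<Rightarrow> 'a) \<times> (nat \<Rightarrow> 'b) \<Rightarrow> real) set" where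
  "cylinder X Y N s t = {H. \<exists>h \<in> bounded_measurable (hist X s \<Otimes>\<^sub>M hist Y t).
     \<forall>x y. (x, y) \<in> space (path_pair X Y N) \<longrightarrow> H (x, y) = h (proj s x, proj t y)}"

lemma cylinderI:
  assumes "h \<in> bounded_measurable (hist X s \<Otimes>\<^sub>M hist Y t)"
    "\<And>x y. (x, y) \<in> space (path_pair X Y N) \<Longrightarrow> H (x, y) = h (proj s x, proj t y)"
  shows "H \<in> cylinder X Y N s t"
  using assms unfolding cylinder_def by blast

lemma cylinderE:
  assumes "H \<in> cylinder X Y N s t"
  obtains h where "h \<in> bounded_measurable (hist X s \<Otimes>\<^sub>M hist Y t)"
    "\<forall>x y. (x, y) \<in> space (path_pair X Y N) \<longrightarrow> H (x, y) = h (proj s x, proj t y)"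
  using assms unfolding cylinder_def by blast

lemma cylinder_cong:
  assumes "G \<in> cylinder X Y N s t" "\<And>z. z \<in> space (path_pair X Y N) \<Longrightarrow> H z = G z"
  shows "H \<in> cylinder X Y N s t"
  using assms unfolding cylinder_def by auto

lemma cylinder_continuous:
  fixes \<phi> :: "real \<times> real \<Rightarrow> real"
  assumes "continuous_on UNIV \<phi>" "H \<in> cylinder X Y N s t" "G \<in> cylinder X Y N s t"
  shows "(\<lambda>z. \<phi> (H z, G z)) \<in> cylinder X Y N s t"
proof -
  obtain h where h: "h \<in> bounded_measurable (hist X s \<Otimes>\<^sub>M hist Y t)"
    "\<forall>x y. (x, y) \<in> space (path_pair X Y N) \<longrightarrow> H (x, y) = h (proj s x, proj t y)"
    using assms(2) by (rule cylinderE)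
  obtain g where g: "g \<in> bounded_measurable (hist X s \<Otimes>\<^sub>M hist Y t)"
    "\<forall>x y. (x, y) \<in> space (path_pair X Y N) \<longrightarrow> G (x, y) = g (proj s x, proj t y)"
    using assms(3) by (rule cylinderE)
  show ?thesis
    by (rule cylinderI[OF bounded_measurable_continuous[OF assms(1) h(1) g(1)]]) (simp add: h(2) g(2))
qed

lemma cylinder_add: "H \<in> cylinder X Y N s t \<Longrightarrow> G \<in> cylinder X Y N s t \<Longrightarrow> (\<lambda>z. H z + G z) \<in> cylinder X Y N s t"
  using cylinder_continuous[of "\<lambda>p. fst p + snd p" H X Y N s t G]
  by (simp add: continuous_on_add continuous_on_diff continuous_on_mult continuous_on_fst continuous_on_snd)

lemma cylinder_diff: "H \<in> cylinder X Y N s t \<Longrightarrow> G \<in> cylinder X Y N s t \<Longrightarrow> (\<lambda>z. H z - G z) \<in> cylinder X Y N s t"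
  using cylinder_continuous[of "\<lambda>p. fst p - snd p" H X Y N s t G]
  by (simp add: continuous_on_add continuous_on_diff continuous_on_mult continuous_on_fst continuous_on_snd)

lemma cylinder_mult: "H \<in> cylinder X Y N s t \<Longrightarrow> G \<in> cylinder X Y N s t \<Longrightarrow> (\<lambda>z. H z * G z) \<in> cylinder X Y N s t"
  using cylinder_continuous[of "\<lambda>p. fst p * snd p" H X Y N s t G]
  by (simp add: continuous_on_add continuous_on_diff continuous_on_mult continuous_on_fst continuous_on_snd)

lemma cylinder_exp: "H \<in> cylinder X Y N s t \<Longrightarrow> (\<lambda>z. exp (H z)) \<in> cylinder X Y N s t"
  using cylinder_continuous[of "\<lambda>p. exp (fst p)" H X Y N s t H]
  by (simp add: continuous_on_exp continuous_on_fst)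

text \<open>Cutting off at \<open>c > 0\<close> makes the logarithm continuous on the whole line and
  changes nothing where \<open>c\<close> is a lower bound.\<close>

lemma cylinder_ln_max:
  assumes "0 < c" "H \<in> cylinder X Y N s t"
  shows "(\<lambda>z. ln (max c (H z))) \<in> cylinder X Y N s t"
proof -
  have "continuous_on UNIV (\<lambda>p :: real \<times> real. ln (max c (fst p)))"
    by (intro continuous_on_ln continuous_on_max continuous_on_const continuous_on_fst continuous_on_id)
      (use assms(1) in \<open>simp add: max_def\<close>)
  from cylinder_continuous[OF this assms(2,2)] show ?thesis by simp
qed

lemma cylinder_const: "(\<lambda>z. c) \<in> cylinder X Y N s t"
  by (rule cylinderI[of "\<lambda>_. c"]) (auto simp: bounded_measurable_def bounded_iff intro!: exI[of _ "\<bar>c\<bar>"])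

lemma cylinder_sum:
  assumes "finite I" "\<And>i. i \<in> I \<Longrightarrow> f i \<in> cylinder X Y N s t"
  shows "(\<lambda>z. \<Sum>i\<in>I. f i z) \<in> cylinder X Y N s t"
  using assms by (induction I rule: finite_induct) (auto intro: cylinder_const cylinder_add)

lemma proj_proj: "s \<le> t \<Longrightarrow> proj s (proj t x) = proj s x"
  by (auto simp: proj_def fun_eq_iff)

lemma proj_full: "x \<in> space (hist X N) \<Longrightarrow> proj N x = x"
  by (auto simp: proj_def hist_def space_PiM)

lemma proj_upd: "t < u \<Longrightarrow> proj t (x(u := a)) = proj t x"
  by (auto simp: proj_def fun_eq_iff)

lemma cylinder_mono:
  assumes "H \<in> cylinder X Y N s t" "s \<le> s'" "t \<le> t'"
  shows "H \<in> cylinder X Y N s' t'"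
proof -
  obtain h where h: "h \<in> bounded_measurable (hist X s \<Otimes>\<^sub>M hist Y t)"
    "\<forall>x y. (x, y) \<in> space (path_pair X Y N) \<longrightarrow> H (x, y) = h (proj s x, proj t y)"
    using assms(1) by (rule cylinderE)
  note [measurable] = proj_measurable[OF assms(2)] proj_measurable[OF assms(3)]
  have "(\<lambda>(x, y). (proj s x, proj t y)) \<in> measurable (hist X s' \<Otimes>\<^sub>M hist Y t') (hist X s \<Otimes>\<^sub>M hist Y t)"
    by measurable
  from bounded_measurable_compose[OF h(1) this] show ?thesis
    by (rule cylinderI) (simp add: h(2) proj_proj assms)
qed

lemma cylinder_bounded_measurable:
  assumes "H \<in> cylinder X Y N s t" "s \<le> N" "t \<le> N"
  shows "H \<in> bounded_measurable (path_pair X Y N)"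
proof -
  obtain h where h: "h \<in> bounded_measurable (hist X N \<Otimes>\<^sub>M hist Y N)"
    "\<forall>x y. (x, y) \<in> space (path_pair X Y N) \<longrightarrow> H (x, y) = h (proj N x, proj N y)"
    using cylinder_mono[OF assms] by (rule cylinderE)
  have eq: "H z = h z" if "z \<in> space (path_pair X Y N)" for z
    using that h(2)[rule_format, of "fst z" "snd z"] by (auto simp: path_pair_def space_pair_measure proj_full)
  have "H ` space (path_pair X Y N) = h ` space (path_pair X Y N)"
    using eq by auto
  moreover have "H \<in> borel_measurable (path_pair X Y N) \<longleftrightarrow> h \<in> borel_measurable (path_pair X Y N)"
    using eq by (rule measurable_cong)
  ultimately show ?thesis using h(1) by (simp add: bounded_measurable_def path_pair_def)
qed

lemma bounded_measurable_cylinder: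
  assumes "H \<in> bounded_measurable (path_pair X Y N)"
  shows "H \<in> cylinder X Y N N N"
  by (rule cylinderI[of H]) (use assms in \<open>auto simp: path_pair_def space_pair_measure proj_full\<close>)

text \<open>Exchanging the two processes lets facts on integrating out an
  \<open>x\<close>-coordinate serve for \<open>y\<close>.\<close>

lemma cylinder_swap:
  assumes "H \<in> cylinder X Y N s t"
  shows "(\<lambda>(y, x). H (x, y)) \<in> cylinder Y X N t s"
proof -
  obtain h where h: "h \<in> bounded_measurable (hist X s \<Otimes>\<^sub>M hist Y t)"
    "\<forall>x y. (x, y) \<in> space (path_pair X Y N) \<longrightarrow> H (x, y) = h (proj s x, proj t y)"
    using assms by (rule cylinderE)
  show ?thesis
    by (rule cylinderI[OF bounded_measurable_compose[OF h(1) measurable_pair_swap']])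
      (auto simp: path_pair_def space_pair_measure h(2))
qed

section \<open>Integrating out one coordinate\<close>

text \<open>The index \<open>t\<close> is the length of the remaining history: coordinate \<open>t + 1\<close> is integrated out.\<close>

definition intX :: "(nat \<Rightarrow> (nat \<Rightarrow> 'a) \<Rightarrow> 'a measure) \<Rightarrow> nat \<Rightarrow> ((nat \<Rightarrow> 'a) \<times> (nat \<Rightarrow> 'b) \<Rightarrow> real) \<Rightarrow>
    (nat \<Rightarrow> 'a) \<times> (nat \<Rightarrow> 'b) \<Rightarrow> real" where
  "intX \<kappa> t H = (\<lambda>(x, y). \<integral>a. H (x(Suc t := a), y) \<partial>\<kappa> (Suc t) (proj t x))"

definition intY :: "(nat \<Rightarrow> (nat \<Rightarrow> 'b) \<Rightarrow> 'b measure) \<Rightarrow> nat \<Rightarrow> ((nat \<Rightarrow> 'a) \<times> (nat \<Rightarrow> 'b) \<Rightarrow> real) \<Rightarrow>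
    (nat \<Rightarrow> 'a) \<times> (nat \<Rightarrow> 'b) \<Rightarrow> real" where
  "intY \<eta> t H = (\<lambda>(x, y). \<integral>b. H (x, y(Suc t := b)) \<partial>\<eta> (Suc t) (proj t y))"

lemma intY_swap: "intY \<eta> t H = (\<lambda>(x, y). intX \<eta> t (\<lambda>(y, x). H (x, y)) (y, x))"
  by (simp add: intX_def intY_def)

text \<open>Only the measurability of one kernel is assumed, and no measure on paths, so that the
  locale can also be interpreted with the two processes exchanged.\<close>

locale kernels =
  fixes X :: "nat \<Rightarrow> 'a topology" and Y :: "nat \<Rightarrow> 'b topology" and N t :: nat
    and \<kappa> :: "nat \<Rightarrow> (nat \<Rightarrow> 'a) \<Rightarrow> 'a measure"
  assumes kernel: "\<kappa> (Suc t) \<in> measurable (hist X t) (prob_algebra (borel_of (X (Suc t))))"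
    and t_less: "t < N"
begin

lemma kernel_at:
  assumes "(x, y) \<in> space (path_pair X Y N)"
  shows "prob_space (\<kappa> (Suc t) (proj t x))" "sets (\<kappa> (Suc t) (proj t x)) = sets (borel_of (X (Suc t)))"
    "space (\<kappa> (Suc t) (proj t x)) = space (borel_of (X (Suc t)))"
proof -
  have "proj t x \<in> space (hist X t)"
    using assms measurable_space[OF proj_measurable[of t N X]] t_less by (auto simp: path_pair_def space_pair_measure)
  from prob_kernel[OF kernel this] show "prob_space (\<kappa> (Suc t) (proj t x))"
    "sets (\<kappa> (Suc t) (proj t x)) = sets (borel_of (X (Suc t)))"
    "space (\<kappa> (Suc t) (proj t x)) = space (borel_of (X (Suc t)))" by auto
qed

lemma upd_space:
  assumes "(x, y) \<in> space (path_pair X Y N)" "a \<in> space (borel_of (X (Suc t)))"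
  shows "(x(Suc t := a), y) \<in> space (path_pair X Y N)"
  using assms t_less by (auto simp: path_pair_def space_pair_measure hist_def space_PiM PiE_iff extensional_def)

lemma intX_eq:
  assumes "\<forall>x y. (x, y) \<in> space (path_pair X Y N) \<longrightarrow> H (x, y) = h (proj (Suc t) x, proj r y)"
    and "(x, y) \<in> space (path_pair X Y N)"
  shows "intX \<kappa> t H (x, y) = (\<integral>a. h ((proj t x)(Suc t := a), proj r y) \<partial>\<kappa> (Suc t) (proj t x))"
  unfolding intX_def prod.case
  by (rule Bochner_Integration.integral_cong)
    (use assms upd_space[OF assms(2)] kernel_at[OF assms(2)] in \<open>auto simp: proj_Suc proj_upd\<close>)

lemma intX_integrable:
  assumes H: "H \<in> cylinder X Y N (Suc t) r" and z: "(x, y) \<in> space (path_pair X Y N)" and r: "r \<le> N"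
  shows "integrable (\<kappa> (Suc t) (proj t x)) (\<lambda>a. H (x(Suc t := a), y))"
proof -
  interpret prob_space "\<kappa> (Suc t) (proj t x)" by (rule kernel_at[OF z])
  have b: "H \<in> bounded_measurable (path_pair X Y N)"
    using cylinder_bounded_measurable[OF H] t_less r by auto
  have "(\<lambda>a. x(Suc t := a)) \<in> measurable (borel_of (X (Suc t))) (hist X N)"
    unfolding hist_def
  proof (rule measurable_PiM_single')
    fix i assume i: "i \<in> {1..N}"
    have "x i \<in> space (borel_of (X i))" using z i by (auto simp: path_pair_def space_pair_measure hist_def space_PiM)
    then show "(\<lambda>a. (x(Suc t := a)) i) \<in> measurable (borel_of (X (Suc t))) (borel_of (X i))"
      by (cases "i = Suc t") auto
  next
    show "(\<lambda>a. x(Suc t := a)) \<in> space (borel_of (X (Suc t))) \<rightarrow> (\<Pi>\<^sub>E i\<in>{1..N}. space (borel_of (X i)))"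
      using upd_space[OF z] by (auto simp: path_pair_def space_pair_measure hist_def space_PiM)
  qed
  then have "(\<lambda>a. (x(Suc t := a), y)) \<in> measurable (\<kappa> (Suc t) (proj t x)) (path_pair X Y N)"
    using z unfolding path_pair_def measurable_cong_sets[OF kernel_at(2)[OF z] refl]
    by (auto simp: space_pair_measure)
  from bounded_measurable_compose[OF b this]
  obtain B where "(\<lambda>a. H (x(Suc t := a), y)) \<in> borel_measurable (\<kappa> (Suc t) (proj t x))"
      "\<And>a. a \<in> space (\<kappa> (Suc t) (proj t x)) \<longrightarrow> \<bar>H (x(Suc t := a), y)\<bar> \<le> B"
    by (auto simp: bounded_measurable_def bounded_iff)
  then show ?thesis by (intro integrable_const_bound[where B=B]) auto
qed

lemma intX_cylinder:
  assumes "H \<in> cylinder X Y N (Suc t) r"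
  shows "intX \<kappa> t H \<in> cylinder X Y N t r"
proof -
  obtain h where h: "h \<in> bounded_measurable (hist X (Suc t) \<Otimes>\<^sub>M hist Y r)"
    "\<forall>x y. (x, y) \<in> space (path_pair X Y N) \<longrightarrow> H (x, y) = h (proj (Suc t) x, proj r y)"
    using assms by (rule cylinderE)
  show ?thesis
    by (rule cylinderI[OF append_kernel_bounded_measurable[OF kernel h(1)]]) (simp add: intX_eq[OF h(2)])
qed

text \<open>\<open>G\<close> does not see coordinate \<open>Suc t\<close>, hence is a constant
  factor of the inner integral. The rule for constant factors asks for no integrability, so
  \<open>H\<close> is arbitrary.\<close>

lemma intX_pull_out:
  assumes G: "G \<in> cylinder X Y N t r" and z: "z \<in> space (path_pair X Y N)"
  shows "intX \<kappa> t (\<lambda>z. G z * H z) z = G z * intX \<kappa> t H z"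
proof -
  obtain x y where xy: "z = (x, y)" by (cases z)
  with z have z': "(x, y) \<in> space (path_pair X Y N)" by simp
  obtain g where g: "\<forall>x y. (x, y) \<in> space (path_pair X Y N) \<longrightarrow> G (x, y) = g (proj t x, proj r y)"
    using cylinderE[OF G] by metis
  have "intX \<kappa> t (\<lambda>z. G z * H z) (x, y) = (\<integral>a. G (x, y) * H (x(Suc t := a), y) \<partial>\<kappa> (Suc t) (proj t x))"
    unfolding intX_def prod.case
    by (rule Bochner_Integration.integral_cong)
      (use g z' upd_space[OF z'] kernel_at[OF z'] in \<open>auto simp: proj_upd\<close>)
  then show ?thesis by (simp add: xy intX_def)
qed

lemma intX_fixed:
  assumes G: "G \<in> cylinder X Y N t r" and z: "z \<in> space (path_pair X Y N)"
  shows "intX \<kappa> t G z = G z"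
proof -
  obtain x y where xy: "z = (x, y)" by (cases z)
  with z have "prob_space (\<kappa> (Suc t) (proj t x))" using kernel_at by simp
  then have "intX \<kappa> t (\<lambda>_. 1) z = 1"
    by (simp add: intX_def xy prob_space.prob_space)
  with intX_pull_out[OF G z, of "\<lambda>_. 1"] show ?thesis by simp
qed

lemma intX_diff:
  assumes H: "H \<in> cylinder X Y N (Suc t) r" "G \<in> cylinder X Y N (Suc t) r" and r: "r \<le> N"
    and z: "z \<in> space (path_pair X Y N)"
  shows "intX \<kappa> t (\<lambda>z. H z - G z) z = intX \<kappa> t H z - intX \<kappa> t G z"
proof -
  obtain x y where xy: "z = (x, y)" by (cases z)
  with z show ?thesis
    using intX_integrable[OF H(1) _ r] intX_integrable[OF H(2) _ r] by (simp add: intX_def)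
qed

text \<open>For fixed \<open>y\<close> the inner integral is over \<mu>, so Fubini reduces the claim
  to \<open>cond_law_integral\<close>. As the processes are independent here, the
  \<open>y\<close>-history may have any length \<open>r \<le> N\<close>.\<close>

lemma integral_intX:
  assumes \<mu>: "\<mu> \<in> space (prob_algebra (hist X N))" and \<nu>: "\<nu> \<in> space (prob_algebra (hist Y N))"
    and reg: "regular_cond_laws X N \<mu> \<kappa>" and t: "1 \<le> t"
    and H: "H \<in> cylinder X Y N (Suc t) r" and r: "r \<le> N"
  shows "(\<integral>z. H z \<partial>(\<mu> \<Otimes>\<^sub>M \<nu>)) = (\<integral>z. intX \<kappa> t H z \<partial>(\<mu> \<Otimes>\<^sub>M \<nu>))"
proof -
  have sets[measurable_cong]: "sets \<mu> = sets (hist X N)" "sets \<nu> = sets (hist Y N)"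
    using \<mu> \<nu> by (auto simp: space_prob_algebra)
  interpret \<mu>: prob_space \<mu> using \<mu> by (simp add: space_prob_algebra)
  interpret \<nu>: prob_space \<nu> using \<nu> by (simp add: space_prob_algebra)
  interpret pair_prob_space \<mu> \<nu> ..
  have sP: "sets (\<mu> \<Otimes>\<^sub>M \<nu>) = sets (path_pair X Y N)"
    unfolding path_pair_def by (rule sets_pair_measure_cong) fact+
  have int: "integrable (\<mu> \<Otimes>\<^sub>M \<nu>) G" if "G \<in> cylinder X Y N (Suc t) r" for G
  proof -
    have "G \<in> bounded_measurable (path_pair X Y N)"
      using cylinder_bounded_measurable[OF that] t_less r by auto
    then obtain B where "G \<in> borel_measurable (\<mu> \<Otimes>\<^sub>M \<nu>)"
        "\<And>z. z \<in> space (\<mu> \<Otimes>\<^sub>M \<nu>) \<Longrightarrow> \<bar>G z\<bar> \<le> B"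
      using sP sets_eq_imp_space_eq[OF sP]
      by (auto simp: bounded_measurable_def bounded_iff cong: measurable_cong_sets)
    then show ?thesis by (intro integrable_const_bound[where B=B]) auto
  qed
  obtain h where h: "h \<in> bounded_measurable (hist X (Suc t) \<Otimes>\<^sub>M hist Y r)"
    "\<forall>x y. (x, y) \<in> space (path_pair X Y N) \<longrightarrow> H (x, y) = h (proj (Suc t) x, proj r y)"
    using H by (rule cylinderE)
  have "(\<integral>z. H z \<partial>(\<mu> \<Otimes>\<^sub>M \<nu>)) = (\<integral>y. \<integral>x. H (x, y) \<partial>\<mu> \<partial>\<nu>)"
    using int[OF H] by (subst integral_snd) auto
  also have "\<dots> = (\<integral>y. \<integral>x. intX \<kappa> t H (x, y) \<partial>\<mu> \<partial>\<nu>)"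
  proof (rule Bochner_Integration.integral_cong[OF refl])
    fix y assume "y \<in> space \<nu>"
    then have y: "y \<in> space (hist Y N)" using sets_eq_imp_space_eq[OF sets(2)] by simp
    have sx: "(x, y) \<in> space (path_pair X Y N)" if "x \<in> space \<mu>" for x
      using that y sets_eq_imp_space_eq[OF sets(1)] by (simp add: path_pair_def space_pair_measure)
    have py: "proj r y \<in> space (hist Y r)" using measurable_space[OF proj_measurable[OF r] y] .
    have F: "(\<lambda>u. h (u, proj r y)) \<in> bounded_measurable (hist X (Suc t))"
      by (rule bounded_measurable_compose[OF h(1)]) (use py in simp)
    have "(\<integral>x. H (x, y) \<partial>\<mu>) = (\<integral>x. h (proj (Suc t) x, proj r y) \<partial>\<mu>)"
      by (rule Bochner_Integration.integral_cong[OF refl]) (use h(2) sx in auto)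
    also have "\<dots> = (\<integral>x. \<integral>a. h ((proj t x)(Suc t := a), proj r y) \<partial>\<kappa> (Suc t) (proj t x) \<partial>\<mu>)"
      by (rule cond_law_integral[OF \<mu> reg _ F]) (use t t_less in auto)
    also have "\<dots> = (\<integral>x. intX \<kappa> t H (x, y) \<partial>\<mu>)"
      by (rule Bochner_Integration.integral_cong[OF refl]) (use intX_eq[OF h(2)] sx in auto)
    finally show "(\<integral>x. H (x, y) \<partial>\<mu>) = (\<integral>x. intX \<kappa> t H (x, y) \<partial>\<mu>)" .
  qed
  also have "\<dots> = (\<integral>z. intX \<kappa> t H z \<partial>(\<mu> \<Otimes>\<^sub>M \<nu>))"
    using int[OF cylinder_mono[OF intX_cylinder[OF H], of "Suc t" r]] by (subst integral_snd) auto
  finally show ?thesis .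
qed

text \<open>A causal plan guarantees the kernel of \<mu> only given the \<open>y\<close>-history up
  to \<open>t\<close>, so \<open>H\<close> is limited to \<open>t\<close> coordinates of
  \<open>y\<close>, in contrast to the product measure.\<close>

lemma causal_integral_intX:
  assumes \<mu>: "\<mu> \<in> space (prob_algebra (hist X N))" and reg: "regular_cond_laws X N \<mu> \<kappa>" and t: "1 \<le> t"
    and \<rho>: "\<rho> \<in> causal_plans X Y N \<mu>" and H: "H \<in> cylinder X Y N (Suc t) t"
  shows "(\<integral>z. H z \<partial>\<rho>) = (\<integral>z. intX \<kappa> t H z \<partial>\<rho>)"
proof -
  note sp = sets_eq_imp_space_eq[OF causal_plansD(2)[OF \<rho>]]
  obtain h where h: "h \<in> bounded_measurable (hist X (Suc t) \<Otimes>\<^sub>M hist Y t)"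
    "\<forall>x y. (x, y) \<in> space (path_pair X Y N) \<longrightarrow> H (x, y) = h (proj (Suc t) x, proj t y)"
    using H by (rule cylinderE)
  have "(\<integral>z. H z \<partial>\<rho>) = (\<integral>(x, y). h (proj (Suc t) x, proj t y) \<partial>\<rho>)"
    by (rule Bochner_Integration.integral_cong) (use h(2) sp in auto)
  also have "\<dots> = (\<integral>(x, y). (\<integral>a. h ((proj t x)(Suc t := a), proj t y) \<partial>\<kappa> (Suc t) (proj t x)) \<partial>\<rho>)"
    by (rule causal_integral[OF \<mu> reg \<rho> _ h(1)]) (use t t_less in auto)
  also have "\<dots> = (\<integral>z. intX \<kappa> t H z \<partial>\<rho>)"
    by (rule Bochner_Integration.integral_cong) (use intX_eq[OF h(2)] sp in auto)
  finally show ?thesis .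
qed

end

lemma intY_pull_out:
  assumes \<eta>: "\<eta> (Suc t) \<in> measurable (hist Y t) (prob_algebra (borel_of (Y (Suc t))))" "t < N"
    and G: "G \<in> cylinder X Y N r t" and z: "z \<in> space (path_pair X Y N)"
  shows "intY \<eta> t (\<lambda>z. G z * H z) z = G z * intY \<eta> t H z"
proof -
  interpret kernels Y X N t \<eta> by unfold_locales fact+
  obtain x y where xy: "z = (x, y)" by (cases z)
  with z have "(y, x) \<in> space (path_pair Y X N)" by (simp add: path_pair_def space_pair_measure)
  from intX_pull_out[OF cylinder_swap[OF G] this, of "\<lambda>(y, x). H (x, y)"]
  show ?thesis by (simp add: xy intY_swap case_prod_unfold)
qed

lemma intY_cylinder:
  assumes \<eta>: "\<eta> (Suc t) \<in> measurable (hist Y t) (prob_algebra (borel_of (Y (Suc t))))" "t < N"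
    and H: "H \<in> cylinder X Y N r (Suc t)"
  shows "intY \<eta> t H \<in> cylinder X Y N r t"
proof -
  interpret kernels Y X N t \<eta> by unfold_locales fact+
  show ?thesis
    using cylinder_swap[OF intX_cylinder[OF cylinder_swap[OF H]]] by (simp add: intY_swap)
qed

lemma integral_intY:
  assumes \<mu>: "\<mu> \<in> space (prob_algebra (hist X N))" and \<nu>: "\<nu> \<in> space (prob_algebra (hist Y N))"
    and reg: "regular_cond_laws Y N \<nu> \<eta>" and t: "1 \<le> t" "t < N"
    and H: "H \<in> cylinder X Y N r (Suc t)" and r: "r \<le> N"
  shows "(\<integral>z. H z \<partial>(\<mu> \<Otimes>\<^sub>M \<nu>)) = (\<integral>z. intY \<eta> t H z \<partial>(\<mu> \<Otimes>\<^sub>M \<nu>))"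
proof -
  have k: "\<eta> (Suc t) \<in> measurable (hist Y t) (prob_algebra (borel_of (Y (Suc t))))"
    using regular_cond_lawsD[OF reg] t by auto
  interpret kernels Y X N t \<eta> by unfold_locales fact+
  have sets[measurable_cong]: "sets \<mu> = sets (hist X N)" "sets \<nu> = sets (hist Y N)"
    using \<mu> \<nu> by (auto simp: space_prob_algebra)
  interpret \<mu>: prob_space \<mu> using \<mu> by (simp add: space_prob_algebra)
  interpret \<nu>: prob_space \<nu> using \<nu> by (simp add: space_prob_algebra)
  interpret pair_prob_space \<mu> \<nu> ..
  have sP: "sets (\<mu> \<Otimes>\<^sub>M \<nu>) = sets (path_pair X Y N)"
    unfolding path_pair_def by (rule sets_pair_measure_cong) fact+
  have m: "G \<in> borel_measurable (\<mu> \<Otimes>\<^sub>M \<nu>)" if "G \<in> cylinder X Y N r (Suc t)" for G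
    using cylinder_bounded_measurable[OF that] t r sP
    by (auto simp: bounded_measurable_def cong: measurable_cong_sets)
  have "(\<integral>z. H z \<partial>(\<mu> \<Otimes>\<^sub>M \<nu>)) = (\<integral>(y, x). H (x, y) \<partial>(\<nu> \<Otimes>\<^sub>M \<mu>))"
    by (rule integral_product_swap[OF m[OF H], symmetric])
  also have "\<dots> = (\<integral>z. intX \<eta> t (\<lambda>(y, x). H (x, y)) z \<partial>(\<nu> \<Otimes>\<^sub>M \<mu>))"
    by (rule integral_intX[OF \<nu> \<mu> reg t(1) cylinder_swap[OF H] r])
  also have "\<dots> = (\<integral>(y, x). intY \<eta> t H (x, y) \<partial>(\<nu> \<Otimes>\<^sub>M \<mu>))"
    by (simp add: intY_swap case_prod_unfold)
  also have "\<dots> = (\<integral>z. intY \<eta> t H z \<partial>(\<mu> \<Otimes>\<^sub>M \<nu>))"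
    by (rule integral_product_swap) (rule m[OF cylinder_mono[OF intY_cylinder[of \<eta> t Y N H X r, OF k t(2) H]]], auto)
  finally show ?thesis .
qed

section \<open>The backward recursion\<close>

text \<open>The bound away from zero keeps the argument of the logarithm in the recursion positive
  and its logarithm bounded.\<close>

lemma prob_space_exp_integral_ge:
  fixes f :: "'w \<Rightarrow> real"
  assumes "prob_space k" and [measurable]: "f \<in> borel_measurable k" and b: "\<And>a. a \<in> space k \<Longrightarrow> \<bar>f a\<bar> \<le> B"
  shows "exp (- B) \<le> (\<integral>a. exp (f a) \<partial>k)"
proof -
  interpret prob_space k by fact
  have "integrable k (\<lambda>a. exp (f a))"
    by (rule integrable_const_bound[where B="exp B"]) (use b in \<open>auto simp: abs_le_iff\<close>)
  then show ?thesis
    by (rule integral_ge_const) (use b in \<open>force simp: abs_le_iff\<close>)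
qed

lemma append_kernel_bounded_measurable_snd:
  assumes k: "k \<in> measurable (hist Y t) (prob_algebra (borel_of (Y (Suc t))))"
    and h: "h \<in> bounded_measurable (B \<Otimes>\<^sub>M hist Y (Suc t))"
  shows "(\<lambda>(u, v). \<integral>b. h (u, v(Suc t := b)) \<partial>k v) \<in> bounded_measurable (B \<Otimes>\<^sub>M hist Y t)"
proof -
  from append_kernel_bounded_measurable[OF k bounded_measurable_compose[OF h measurable_pair_swap']]
  have "(\<lambda>(v, u). \<integral>b. h (u, v(Suc t := b)) \<partial>k v) \<in> bounded_measurable (hist Y t \<Otimes>\<^sub>M B)"
    by simp
  from bounded_measurable_compose[OF this measurable_pair_swap'] show ?thesis
    by (simp add: case_prod_unfold)
qed

lemma bounded_measurable_exp:
  "f \<in> bounded_measurable M \<Longrightarrow> (\<lambda>z. exp (f z)) \<in> bounded_measurable M"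
  using bounded_measurable_continuous[of "\<lambda>p. exp (fst p)" f M f]
  by (simp add: continuous_on_exp continuous_on_fst)

lemma bounded_measurable_uminus:
  "f \<in> bounded_measurable M \<Longrightarrow> (\<lambda>z. - f z) \<in> bounded_measurable M"
  using bounded_measurable_continuous[of "\<lambda>p. - fst p" f M f]
  by (simp add: continuous_on_minus continuous_on_fst)

lemma bounded_measurable_cong:
  assumes "f \<in> bounded_measurable M" "\<And>z. z \<in> space M \<Longrightarrow> g z = f z"
  shows "g \<in> bounded_measurable M"
proof -
  have "g ` space M = f ` space M" using assms(2) by auto
  moreover have "g \<in> borel_measurable M \<longleftrightarrow> f \<in> borel_measurable M" using assms(2) by (rule measurable_cong)
  ultimately show ?thesis using assms(1) by (simp add: bounded_measurable_def)
qed

lemma bounded_measurable_neg_ln: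
  assumes f: "f \<in> bounded_measurable M" and c: "0 < c" "\<And>z. z \<in> space M \<Longrightarrow> c \<le> f z"
  shows "(\<lambda>z. - ln (f z)) \<in> bounded_measurable M"
proof -
  have "continuous_on UNIV (\<lambda>p :: real \<times> real. - ln (max c (fst p)))"
    by (intro continuous_on_minus continuous_on_ln continuous_on_max continuous_on_const continuous_on_fst continuous_on_id)
      (use c(1) in \<open>simp add: max_def\<close>)
  from bounded_measurable_continuous[OF this f f] show ?thesis
    by (rule bounded_measurable_cong) (use c(2) in \<open>simp add: max_absorb2\<close>)
qed

lemma exp_kernel_integral_ge:
  assumes k: "k \<in> measurable (hist Y t) (prob_algebra (borel_of (Y (Suc t))))"
    and h: "h \<in> bounded_measurable (B \<Otimes>\<^sub>M hist Y (Suc t))"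
  obtains c where "0 < c" "\<And>u v. u \<in> space B \<Longrightarrow> v \<in> space (hist Y t) \<Longrightarrow>
    c \<le> (\<integral>b. exp (h (u, v(Suc t := b))) \<partial>k v)"
proof -
  obtain b where b: "\<And>z. z \<in> space (B \<Otimes>\<^sub>M hist Y (Suc t)) \<Longrightarrow> \<bar>h z\<bar> \<le> b"
    using h by (auto simp: bounded_measurable_def bounded_iff)
  have "exp (- b) \<le> (\<integral>b. exp (h (u, v(Suc t := b))) \<partial>k v)" if u: "u \<in> space B" and v: "v \<in> space (hist Y t)" for u v
  proof (rule prob_space_exp_integral_ge)
    note kv = prob_kernel[OF k v]
    show "prob_space (k v)" by (rule kv)
    have m: "(\<lambda>b. v(Suc t := b)) \<in> measurable (borel_of (Y (Suc t))) (hist Y (Suc t))"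
      using measurable_compose[OF measurable_Pair1'[OF v] append_measurable] by simp
    then have "(\<lambda>b. (u, v(Suc t := b))) \<in> measurable (k v) (B \<Otimes>\<^sub>M hist Y (Suc t))"
      unfolding measurable_cong_sets[OF kv(2) refl] using u by simp
    from bounded_measurable_compose[OF h this]
    show "(\<lambda>b. h (u, v(Suc t := b))) \<in> borel_measurable (k v)" by (simp add: bounded_measurable_def)
    fix a assume "a \<in> space (k v)"
    then show "\<bar>h (u, v(Suc t := a))\<bar> \<le> b"
      using measurable_space[OF m, of a] kv u by (intro b) (simp add: space_pair_measure)
  qed
  with that[of "exp (- b)"] show thesis by simp
qed

lemma a_step_bounded_measurable:
  assumes k: "\<eta> (Suc t) \<in> measurable (hist Y t) (prob_algebra (borel_of (Y (Suc t))))"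
    and h: "h \<in> bounded_measurable (B \<Otimes>\<^sub>M hist Y (Suc t))"
  shows "a_step \<eta> (Suc t) h \<in> bounded_measurable (B \<Otimes>\<^sub>M hist Y t)"
proof -
  obtain c where c: "0 < c" "\<And>u v. u \<in> space B \<Longrightarrow> v \<in> space (hist Y t) \<Longrightarrow>
      c \<le> (\<integral>b. exp (h (u, v(Suc t := b))) \<partial>\<eta> (Suc t) v)"
    using exp_kernel_integral_ge[OF k h] by metis
  have "(\<lambda>z. - ln ((\<lambda>(u, v). \<integral>b. exp (h (u, v(Suc t := b))) \<partial>\<eta> (Suc t) v) z)) \<in> bounded_measurable (B \<Otimes>\<^sub>M hist Y t)"
    by (rule bounded_measurable_neg_ln[OF append_kernel_bounded_measurable_snd[OF k bounded_measurable_exp[OF h]] c(1)])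
      (auto simp: space_pair_measure c(2))
  then show ?thesis by (simp add: a_step_def case_prod_unfold)
qed

lemma singleton_measurable: "(\<lambda>a. \<lambda>i\<in>{1}. a) \<in> measurable (borel_of (X 1)) (hist X 1)"
  unfolding hist_def atLeastAtMost_singleton by (rule measurable_restrict) auto

text \<open>A history of length zero is the single path that is \<open>undefined\<close> everywhere,
  so \<open>h\<close> depends only on \<open>x\<close> and its integral only on the first
  marginal.\<close>

lemma integral_marginal:
  assumes \<rho>: "sets \<rho> = sets (path_pair X Y N)" "distr \<rho> (hist X N) fst = \<mu>"
    and h: "h \<in> bounded_measurable (hist X s \<Otimes>\<^sub>M hist Y 0)" "s \<le> N"
    and H: "\<forall>x y. (x, y) \<in> space (path_pair X Y N) \<longrightarrow> H (x, y) = h (proj s x, proj 0 y)"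
  shows "(\<integral>z. H z \<partial>\<rho>) = (\<integral>x. h (proj s x, \<lambda>_. undefined) \<partial>\<mu>)"
proof -
  have p0: "proj 0 y = (\<lambda>_. undefined)" for y :: "nat \<Rightarrow> 'b" by (simp add: proj_def restrict_def)
  have "(\<lambda>x. (x, \<lambda>_. undefined)) \<in> measurable (hist X s) (hist X s \<Otimes>\<^sub>M hist Y 0)"
    by (rule measurable_Pair2') (simp add: hist_def space_PiM)
  from bounded_measurable_compose[OF bounded_measurable_compose[OF h(1) this] proj_measurable[OF h(2)]]
  have m: "(\<lambda>x. h (proj s x, \<lambda>_. undefined)) \<in> borel_measurable (hist X N)"
    by (simp add: bounded_measurable_def)
  have f: "fst \<in> measurable \<rho> (hist X N)"
    unfolding measurable_cong_sets[OF \<rho>(1) refl] path_pair_def by (rule measurable_fst)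
  have "(\<integral>z. H z \<partial>\<rho>) = (\<integral>z. h (proj s (fst z), \<lambda>_. undefined) \<partial>\<rho>)"
    by (rule Bochner_Integration.integral_cong[OF refl])
      (use H sets_eq_imp_space_eq[OF \<rho>(1)] in \<open>auto simp: p0\<close>)
  also have "\<dots> = (\<integral>x. h (proj s x, \<lambda>_. undefined) \<partial>\<mu>)"
    unfolding \<rho>(2)[symmetric] by (rule integral_distr[OF f m, symmetric])
  finally show ?thesis .
qed

section \<open>The data of the problem, orthogonal projections and the recursive potentials\<close>

locale causal_problem =
  fixes N :: nat and X :: "nat \<Rightarrow> 'a topology" and Y :: "nat \<Rightarrow> 'b topology"
    and \<mu> :: "(nat \<Rightarrow> 'a) measure" and \<nu> :: "(nat \<Rightarrow> 'b) measure"
    and \<kappa> :: "nat \<Rightarrow> (nat \<Rightarrow> 'a) \<Rightarrow> 'a measure" and \<eta> :: "nat \<Rightarrow> (nat \<Rightarrow> 'b) \<Rightarrow> 'b measure"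
    and g :: "(nat \<Rightarrow> 'a) \<times> (nat \<Rightarrow> 'b) \<Rightarrow> real"
  assumes N: "1 \<le> N"
    and \<mu>: "\<mu> \<in> space (prob_algebra (hist X N))" and \<nu>: "\<nu> \<in> space (prob_algebra (hist Y N))"
    and reg_\<kappa>: "regular_cond_laws X N \<mu> \<kappa>" and reg_\<eta>: "regular_cond_laws Y N \<nu> \<eta>"
    and g: "g \<in> bounded_measurable (path_pair X Y N)"
begin

abbreviation P :: "((nat \<Rightarrow> 'a) \<times> (nat \<Rightarrow> 'b)) measure" where "P \<equiv> \<mu> \<Otimes>\<^sub>M \<nu>"
abbreviation cyl where "cyl \<equiv> cylinder X Y N"
abbreviation \<Omega> where "\<Omega> \<equiv> space (path_pair X Y N)"
abbreviation f_opt where "f_opt \<equiv> f_rec N \<kappa> (distr \<nu> (borel_of (Y 1)) (\<lambda>y. y 1)) \<eta> g"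

text \<open>\<open>G\<close> and \<open>A\<close> read the recursion, which lives on histories, off
  whole paths, so that \<open>intX\<close> and \<open>intY\<close> apply. \<open>A t\<close> stops
  at \<open>t - 1\<close> on the \<open>y\<close> side because \<open>y t\<close> has been
  integrated out.\<close>

definition G where "G t = (\<lambda>(x, y). g_rec N \<kappa> \<eta> g t (proj t x, proj t y))"
definition A where "A t = (\<lambda>(x, y). a_rec N \<kappa> \<eta> g t (proj t x, proj (t - 1) y))"

lemma sets_\<mu>: "sets \<mu> = sets (hist X N)" and sets_\<nu>: "sets \<nu> = sets (hist Y N)"
  using \<mu> \<nu> by (auto simp: space_prob_algebra)

sublocale \<mu>: prob_space \<mu> using \<mu> by (simp add: space_prob_algebra)
sublocale \<nu>: prob_space \<nu> using \<nu> by (simp add: space_prob_algebra)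
sublocale pair_prob_space \<mu> \<nu> ..

lemma sets_P: "sets P = sets (path_pair X Y N)"
  unfolding path_pair_def by (rule sets_pair_measure_cong) (rule sets_\<mu> sets_\<nu>)+

lemma space_P: "space P = \<Omega>"
  by (rule sets_eq_imp_space_eq[OF sets_P])

lemma \<kappa>_kernels: "t \<in> {1..<N} \<Longrightarrow> kernels X N t \<kappa>"
  using regular_cond_lawsD(1)[OF reg_\<kappa>] by unfold_locales auto

lemma \<eta>_kernel: "t \<in> {1..<N} \<Longrightarrow> \<eta> (Suc t) \<in> measurable (hist Y t) (prob_algebra (borel_of (Y (Suc t))))"
  using regular_cond_lawsD(1)[OF reg_\<eta>] by auto

lemma integrable_cyl: "H \<in> cyl s t \<Longrightarrow> s \<le> N \<Longrightarrow> t \<le> N \<Longrightarrow> integrable P H"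
proof -
  assume "H \<in> cyl s t" "s \<le> N" "t \<le> N"
  then have "H \<in> bounded_measurable (path_pair X Y N)" by (rule cylinder_bounded_measurable)
  then obtain B where "H \<in> borel_measurable P" "\<And>z. z \<in> space P \<Longrightarrow> \<bar>H z\<bar> \<le> B"
    unfolding space_P bounded_measurable_def measurable_cong_sets[OF sets_P refl] bounded_iff by auto
  then show "integrable P H" by (intro integrable_const_bound[where B=B]) auto
qed

lemma integral_P_cong: "(\<And>z. z \<in> \<Omega> \<Longrightarrow> F z = H z) \<Longrightarrow> (\<integral>z. F z \<partial>P) = (\<integral>z. H z \<partial>P)"
  by (rule Bochner_Integration.integral_cong) (auto simp: space_P)

lemma AE_zero_cyl:
  assumes D: "D \<in> cyl s t" "s \<le> N" "t \<le> N" and 0: "(\<integral>z. D z * D z \<partial>P) = 0"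
  shows "AE z in P. D z = 0"
  using integral_nonneg_eq_0_iff_AE[OF integrable_cyl[OF cylinder_mult[OF D(1,1)] D(2,3)]] 0 by auto

text \<open>
  The next two lemmas use that \<open>intX \<kappa> t\<close> is the orthogonal projection in \<open>L\<^sup>2(P)\<close>; the squared norm of
  the difference is computed to be zero.
\<close>

lemma AE_eq_intX:
  assumes t: "t \<in> {1..<N}" and E: "E \<in> cyl (Suc t) t"
    and orth: "\<And>F. F \<in> cyl (Suc t) t \<Longrightarrow> (\<integral>z. F z * E z \<partial>P) = (\<integral>z. intX \<kappa> t F z * E z \<partial>P)"
  shows "AE z in P. E z = intX \<kappa> t E z"
proof -
  interpret kernels X Y N t \<kappa> by (rule \<kappa>_kernels[OF t])
  let ?D = "\<lambda>z. E z - intX \<kappa> t E z"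
  have le: "Suc t \<le> N" "t \<le> N" using t by auto
  have iE: "intX \<kappa> t E \<in> cyl t t" by (rule intX_cylinder[OF E])
  have iE': "intX \<kappa> t E \<in> cyl (Suc t) t" by (rule cylinder_mono[OF iE]) auto
  have D: "?D \<in> cyl (Suc t) t" by (rule cylinder_diff[OF E iE'])
  have iD: "intX \<kappa> t ?D z = 0" if "z \<in> \<Omega>" for z
    using intX_diff[OF E iE' le(2) that] intX_fixed[OF iE that] by simp
  \<comment> \<open>\<open>?D\<close> has conditional mean zero, so testing with it shows that it is
    orthogonal to \<open>E\<close>.\<close>
  have "(\<integral>z. ?D z * E z \<partial>P) = (\<integral>z. intX \<kappa> t ?D z * E z \<partial>P)" by (rule orth[OF D])
  also have "\<dots> = (\<integral>z. 0 \<partial>P)" by (rule integral_P_cong) (simp add: iD)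
  finally have 1: "(\<integral>z. ?D z * E z \<partial>P) = 0" by simp
  \<comment> \<open>The factor \<open>intX \<kappa> t E\<close> does not depend on the integrated
    coordinate and can be pulled out, so \<open>?D\<close> is orthogonal to it as well.\<close>
  have "(\<integral>z. intX \<kappa> t E z * ?D z \<partial>P) = (\<integral>z. intX \<kappa> t (\<lambda>z. intX \<kappa> t E z * ?D z) z \<partial>P)"
    by (rule integral_intX[OF \<mu> \<nu> reg_\<kappa> _ cylinder_mult[OF iE' D]]) (use t in auto)
  also have "\<dots> = (\<integral>z. 0 \<partial>P)"
    by (rule integral_P_cong) (simp add: intX_pull_out[OF iE] iD)
  finally have 2: "(\<integral>z. intX \<kappa> t E z * ?D z \<partial>P) = 0" by simp
  have "(\<integral>z. ?D z * ?D z \<partial>P) = (\<integral>z. ?D z * E z - intX \<kappa> t E z * ?D z \<partial>P)"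
    by (rule integral_P_cong) (simp add: algebra_simps)
  also have "\<dots> = (\<integral>z. ?D z * E z \<partial>P) - (\<integral>z. intX \<kappa> t E z * ?D z \<partial>P)"
    by (rule Bochner_Integration.integral_diff)
      (rule integrable_cyl[OF cylinder_mult[OF D E] le] integrable_cyl[OF cylinder_mult[OF iE' D] le])+
  finally have "AE z in P. ?D z = 0"
    using AE_zero_cyl[OF D le] 1 2 by simp
  then show ?thesis by simp
qed

lemma AE_eq_intX_of_AE_eq:
  assumes t: "t \<in> {1..<N}" and h: "h \<in> cyl (Suc t) t" and W: "W \<in> cyl t t" and eq: "AE z in P. h z = W z"
  shows "AE z in P. h z = intX \<kappa> t h z"
proof -
  interpret kernels X Y N t \<kappa> by (rule \<kappa>_kernels[OF t])
  let ?D = "\<lambda>z. W z - intX \<kappa> t h z"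
  have le: "Suc t \<le> N" "t \<le> N" using t by auto
  have ih: "intX \<kappa> t h \<in> cyl t t" by (rule intX_cylinder[OF h])
  have D: "?D \<in> cyl t t" by (rule cylinder_diff[OF W ih])
  have D': "?D \<in> cyl (Suc t) t" by (rule cylinder_mono[OF D]) auto
  have iDh: "integrable P (\<lambda>z. ?D z * h z)" "integrable P (\<lambda>z. ?D z * W z)" "integrable P (\<lambda>z. ?D z * intX \<kappa> t h z)"
    using integrable_cyl[OF cylinder_mult[OF D' h]] integrable_cyl[OF cylinder_mult[OF D W]]
      integrable_cyl[OF cylinder_mult[OF D ih]] le by auto
  \<comment> \<open>Replacing \<open>W\<close> by \<open>h\<close> and projecting shows that
    \<open>W\<close> and \<open>intX \<kappa> t h\<close> have the same inner product with
    \<open>?D\<close>; as \<open>?D\<close> is their difference, its norm is zero.\<close>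
  have "(\<integral>z. ?D z * W z \<partial>P) = (\<integral>z. ?D z * h z \<partial>P)"
    by (rule integral_cong_AE) (use iDh eq in \<open>auto elim!: eventually_mono\<close>)
  also have "\<dots> = (\<integral>z. intX \<kappa> t (\<lambda>z. ?D z * h z) z \<partial>P)"
    by (rule integral_intX[OF \<mu> \<nu> reg_\<kappa> _ cylinder_mult[OF D' h]]) (use t in auto)
  also have "\<dots> = (\<integral>z. ?D z * intX \<kappa> t h z \<partial>P)"
    by (rule integral_P_cong) (rule intX_pull_out[OF D])
  finally have "(\<integral>z. ?D z * W z \<partial>P) - (\<integral>z. ?D z * intX \<kappa> t h z \<partial>P) = 0" by simp
  then have "(\<integral>z. ?D z * W z - ?D z * intX \<kappa> t h z \<partial>P) = 0"
    using iDh by simp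
  then have "(\<integral>z. ?D z * ?D z \<partial>P) = 0" by (simp add: right_diff_distrib)
  from AE_zero_cyl[OF D le(2,2) this] eq show ?thesis by eventually_elim simp
qed

text \<open>By downward induction from \<open>N\<close>: averaging over a kernel preserves
  boundedness, and the logarithm acts on values bounded away from zero.\<close>

lemma g_rec_bounded_measurable:
  assumes "t \<in> {1..N}"
  shows "g_rec N \<kappa> \<eta> g t \<in> bounded_measurable (hist X t \<Otimes>\<^sub>M hist Y t)"
proof -
  from assms have "t \<le> N" "1 \<le> t" by auto
  then show ?thesis
  proof (induction t rule: inc_induct)
    case base
    then show ?case using g by (subst g_rec.simps) (simp add: path_pair_def)
  next
    case (step n)
    then have n: "n \<in> {1..<N}" by auto
    have "a_step \<eta> (Suc n) (g_rec N \<kappa> \<eta> g (Suc n)) \<in> bounded_measurable (hist X (Suc n) \<Otimes>\<^sub>M hist Y n)"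
      by (rule a_step_bounded_measurable[of \<eta> n Y, OF \<eta>_kernel[OF n]]) (use step in auto)
    from bounded_measurable_uminus[OF append_kernel_bounded_measurable[OF regular_cond_lawsD(1)[OF reg_\<kappa> n] this]]
    show ?case using n by (subst g_rec.simps) (simp add: g_step_def case_prod_unfold)
  qed
qed

lemma a_rec_bounded_measurable:
  assumes "t \<in> {1..<N}"
  shows "a_rec N \<kappa> \<eta> g (Suc t) \<in> bounded_measurable (hist X (Suc t) \<Otimes>\<^sub>M hist Y t)"
  unfolding a_rec_def
  by (rule a_step_bounded_measurable[of \<eta> t Y, OF \<eta>_kernel[OF assms] g_rec_bounded_measurable]) (use assms in auto)

lemma G_cyl: "t \<in> {1..N} \<Longrightarrow> G t \<in> cyl t t"
  by (rule cylinderI[OF g_rec_bounded_measurable]) (auto simp: G_def)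

lemma A_cyl: "t \<in> {1..<N} \<Longrightarrow> A (Suc t) \<in> cyl (Suc t) t"
  by (rule cylinderI[OF a_rec_bounded_measurable]) (auto simp: A_def)

lemma intX_A: "t \<in> {1..<N} \<Longrightarrow> intX \<kappa> t (A (Suc t)) z = - G t z"
  by (cases z) (simp add: intX_def A_def G_def g_rec.simps[of N \<kappa> \<eta> g t] g_step_def a_rec_def proj_Suc proj_upd)

text \<open>The exponential undoes the logarithm in \<open>a_step\<close> because the uniform lower
  bound keeps the inner integral positive.\<close>

lemma intY_G:
  assumes t: "t \<in> {1..<N}" and z: "z \<in> \<Omega>"
  shows "intY \<eta> t (\<lambda>z. exp (G (Suc t) z)) z = exp (- A (Suc t) z)"
proof -
  obtain x y where xy: "z = (x, y)" by (cases z)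
  obtain c where c: "0 < c" "\<And>u v. u \<in> space (hist X (Suc t)) \<Longrightarrow> v \<in> space (hist Y t) \<Longrightarrow>
      c \<le> (\<integral>b. exp (g_rec N \<kappa> \<eta> g (Suc t) (u, v(Suc t := b))) \<partial>\<eta> (Suc t) v)"
    using exp_kernel_integral_ge[OF \<eta>_kernel[OF t] g_rec_bounded_measurable[of "Suc t"]] t
    by (metis atLeastAtMost_iff atLeastLessThan_iff le_Suc_eq less_eq_Suc_le)
  have "proj (Suc t) x \<in> space (hist X (Suc t))" "proj t y \<in> space (hist Y t)"
    using z t measurable_space[OF proj_measurable[of "Suc t" N X], of x] measurable_space[OF proj_measurable[of t N Y], of y]
    by (auto simp: xy path_pair_def space_pair_measure)
  from c(2)[OF this] c(1)
  have "0 < (\<integral>b. exp (g_rec N \<kappa> \<eta> g (Suc t) (proj (Suc t) x, (proj t y)(Suc t := b))) \<partial>\<eta> (Suc t) (proj t y))"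
    by simp
  then show ?thesis
    by (simp add: xy intY_def A_def G_def a_rec_def a_step_def proj_Suc[of t "y(Suc t := _)"] proj_upd)
qed

lemma f_opt_Suc: "1 \<le> t \<Longrightarrow> f_opt (Suc t) z = A (Suc t) z + G t z"
  by (cases z) (simp add: f_rec_def A_def G_def)

text \<open>Such an \<open>f\<close> is \<open>H - intX \<kappa> t H\<close> on the path space, and
  projecting twice is the same as projecting once.\<close>

lemma A_set_Suc:
  assumes t: "t \<in> {1..<N}" and f: "f \<in> A_set X Y N \<kappa> (Suc t)"
  shows "f \<in> cyl (Suc t) t" and "z \<in> \<Omega> \<Longrightarrow> intX \<kappa> t f z = 0"
proof -
  interpret kernels X Y N t \<kappa> by (rule \<kappa>_kernels[OF t])
  obtain a where a: "a \<in> bounded_measurable (hist X (Suc t) \<Otimes>\<^sub>M hist Y t)"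
    "\<And>x y. (x, y) \<in> \<Omega> \<Longrightarrow> f (x, y) = a (proj (Suc t) x, proj t y)
        - (\<integral>x'. a ((proj t x)(Suc t := x'), proj t y) \<partial>\<kappa> (Suc t) (proj t x))"
    using f t by (auto simp: A_set_def)
  define H where "H = (\<lambda>(x, y). a (proj (Suc t) x, proj t y))"
  have H: "H \<in> cyl (Suc t) t" by (rule cylinderI[OF a(1)]) (simp add: H_def)
  have iH: "intX \<kappa> t H \<in> cyl t t" by (rule intX_cylinder[OF H])
  have iH': "intX \<kappa> t H \<in> cyl (Suc t) t" by (rule cylinder_mono[OF iH]) auto
  have f_eq: "f z = H z - intX \<kappa> t H z" if "z \<in> \<Omega>" for z
    using that by (cases z) (simp add: a(2) H_def intX_def proj_Suc proj_upd)
  show "f \<in> cyl (Suc t) t" by (rule cylinder_cong[OF cylinder_diff[OF H iH'] f_eq])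
  assume z: "z \<in> \<Omega>"
  obtain x y where xy: "z = (x, y)" by (cases z)
  have "intX \<kappa> t f z = intX \<kappa> t (\<lambda>z. H z - intX \<kappa> t H z) z"
    unfolding intX_def xy prod.case
    by (rule Bochner_Integration.integral_cong)
      (use z upd_space kernel_at in \<open>auto simp: xy f_eq[unfolded intX_def]\<close>)
  also have "\<dots> = 0"
    using intX_diff[OF H iH' _ z] intX_fixed[OF iH z] t by simp
  finally show "intX \<kappa> t f z = 0" .
qed

lemma A_set_1:
  assumes f: "f \<in> A_set X Y N \<kappa> 1"
  shows "f \<in> cyl 1 0"
proof -
  obtain a where a: "a \<in> bounded_measurable (borel_of (X 1))" "\<And>x y. (x, y) \<in> \<Omega> \<Longrightarrow> f (x, y) = a (x 1)"
    using f by (auto simp: A_set_def)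
  have "(\<lambda>(u, v). u 1) \<in> measurable (hist X 1 \<Otimes>\<^sub>M hist Y 0) (borel_of (X 1))"
    using measurable_compose[OF measurable_fst component_measurable[of 1 1 X]] by (simp add: case_prod_unfold)
  from bounded_measurable_compose[OF a(1) this] show ?thesis
    by (rule cylinderI) (simp add: a(2) proj_def)
qed

text \<open>For \<open>t > 1\<close> the witness is \<open>a_rec\<close> itself, because
  \<open>g_rec\<close> at \<open>t - 1\<close> is minus its conditional mean. For
  \<open>t = 1\<close> it is \<open>- ln\<close> of an integral depending on \<open>x 1\<close>,
  which is bounded and stays above \<open>exp (- B)\<close>.\<close>

lemma f_opt_A_set:
  assumes t: "t \<in> {1..N}"
  shows "f_opt t \<in> A_set X Y N \<kappa> t"
proof (cases "t = 1")
  case True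
  let ?\<nu>1 = "distr \<nu> (borel_of (Y 1)) (\<lambda>y. y 1)"
  have "(\<lambda>y. y 1) \<in> measurable \<nu> (borel_of (Y 1))"
    unfolding measurable_cong_sets[OF sets_\<nu> refl] by (rule component_measurable) (use N in auto)
  then interpret \<nu>1: prob_space ?\<nu>1 by (rule \<nu>.prob_space_distr)
  \<comment> \<open>The law of the first \<open>y\<close>-coordinate is treated as a constant
    kernel, so that the kernel lemma gives measurability in \<open>x 1\<close>.\<close>
  have k: "(\<lambda>_. ?\<nu>1) \<in> measurable (borel_of (X 1)) (prob_algebra (borel_of (Y 1)))"
    by (rule measurable_const) (simp add: space_prob_algebra \<nu>1.prob_space_axioms del: One_nat_def)
  have "(\<lambda>(a, b). (\<lambda>i\<in>{1}. a, \<lambda>i\<in>{1}. b)) \<in> measurable (borel_of (X 1) \<Otimes>\<^sub>M borel_of (Y 1)) (hist X 1 \<Otimes>\<^sub>M hist Y 1)"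
    using singleton_measurable[of X] singleton_measurable[of Y] by measurable
  from bounded_measurable_compose[OF g_rec_bounded_measurable[of 1] this] N
  have F: "(\<lambda>(a, b). g_rec N \<kappa> \<eta> g 1 (\<lambda>i\<in>{1}. a, \<lambda>i\<in>{1}. b)) \<in> bounded_measurable (borel_of (X 1) \<Otimes>\<^sub>M borel_of (Y 1))"
    (is "?F \<in> _") by (simp add: case_prod_unfold)
  then obtain B where B: "\<And>z. z \<in> space (borel_of (X 1) \<Otimes>\<^sub>M borel_of (Y 1)) \<Longrightarrow> \<bar>?F z\<bar> \<le> B"
    unfolding bounded_measurable_def bounded_iff by fastforce
  let ?Z = "\<lambda>a. \<integral>b. exp (?F (a, b)) \<partial>?\<nu>1"
  have Z: "?Z \<in> bounded_measurable (borel_of (X 1))"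
    using kernel_integral_bounded_measurable[OF k bounded_measurable_exp[OF F]] by simp
  have "exp (- B) \<le> ?Z a" if a: "a \<in> space (borel_of (X 1))" for a
  proof (rule prob_space_exp_integral_ge[OF \<nu>1.prob_space_axioms])
    show "(\<lambda>b. ?F (a, b)) \<in> borel_measurable ?\<nu>1"
      using measurable_compose[OF measurable_Pair1'[OF a], of ?F] F by (simp add: bounded_measurable_def)
    show "\<bar>?F (a, b)\<bar> \<le> B" if "b \<in> space ?\<nu>1" for b
      using that a by (intro B) (simp add: space_pair_measure)
  qed
  from bounded_measurable_neg_ln[OF Z _ this]
  have "(\<lambda>a. - ln (?Z a)) \<in> bounded_measurable (borel_of (X 1))" by simp
  moreover have "f_opt 1 (x, y) = - ln (?Z (x 1))" for x y
  proof -
    have "proj 1 x = (\<lambda>i\<in>{1}. x 1)" by (auto simp: proj_def fun_eq_iff)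
    then show ?thesis by (simp add: f_rec_def)
  qed
  ultimately show ?thesis unfolding A_set_def True by auto
next
  case False
  then obtain u where u: "t = Suc u" "u \<in> {1..<N}" using t by (cases t) auto
  have "f_opt t (x, y) = a_rec N \<kappa> \<eta> g t (proj t x, proj (t - 1) y)
      - (\<integral>x'. a_rec N \<kappa> \<eta> g t ((proj (t - 1) x)(t := x'), proj (t - 1) y) \<partial>\<kappa> t (proj (t - 1) x))" for x y
    using f_opt_Suc[of u "(x, y)"] intX_A[OF u(2), of "(x, y)"] u
    by (simp add: A_def intX_def proj_Suc proj_upd)
  then show ?thesis using a_rec_bounded_measurable[OF u(2)] False u(1) by (auto simp: A_set_def)
qed

end

section \<open>Integrals of the potentials under causal plans\<close>

context causal_problem
begin

lemma A_set_cyl: "t \<in> {1..N} \<Longrightarrow> f \<in> A_set X Y N \<kappa> t \<Longrightarrow> f \<in> cyl t t"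
proof -
  assume t: "t \<in> {1..N}" and f: "f \<in> A_set X Y N \<kappa> t"
  show "f \<in> cyl t t"
  proof (cases "t = 1")
    case True
    with f have "f \<in> cyl 1 0" using A_set_1 by simp
    from cylinder_mono[OF this, of t t] show ?thesis using True by simp
  next
    case False
    then obtain u where u: "t = Suc u" "u \<in> {1..<N}" using t by (cases t) auto
    with f have "f \<in> cyl (Suc u) u" using A_set_Suc(1)[of u f] by simp
    from cylinder_mono[OF this, of t t] show ?thesis using u by simp
  qed
qed

lemma distr_fst_P: "distr P (hist X N) fst = \<mu>"
proof -
  have "distr P (hist X N) fst = distr P \<mu> fst"
    by (rule distr_cong) (auto simp: sets_\<mu>)
  then show ?thesis using \<nu>.distr_pair_fst by (simp add: \<nu>.emeasure_space_1)
qed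

text \<open>Such an \<open>H\<close> depends on \<open>x\<close> alone, and \<rho> and
  \<open>P\<close> share the first marginal \<mu>.\<close>

lemma integral_cyl_fst:
  assumes \<rho>: "\<rho> \<in> causal_plans X Y N \<mu>" and H: "H \<in> cyl s 0" "s \<le> N"
  shows "(\<integral>z. H z \<partial>\<rho>) = (\<integral>z. H z \<partial>P)"
proof -
  obtain h where h: "h \<in> bounded_measurable (hist X s \<Otimes>\<^sub>M hist Y 0)"
    "\<forall>x y. (x, y) \<in> \<Omega> \<longrightarrow> H (x, y) = h (proj s x, proj 0 y)"
    using H(1) by (rule cylinderE)
  show ?thesis
    using integral_marginal[OF causal_plansD(2,3)[OF \<rho>] h(1) H(2) h(2)]
      integral_marginal[OF sets_P distr_fst_P h(1) H(2) h(2)] by simp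
qed

lemma integrable_plan_cyl:
  assumes \<rho>: "prob_space \<rho>" "sets \<rho> = sets (path_pair X Y N)" and H: "H \<in> cyl s t" "s \<le> N" "t \<le> N"
  shows "integrable \<rho> H"
proof -
  interpret \<rho>: prob_space \<rho> by fact
  have "H \<in> bounded_measurable (path_pair X Y N)" using H by (rule cylinder_bounded_measurable)
  then obtain B where "H \<in> borel_measurable \<rho>" "\<And>z. z \<in> space \<rho> \<Longrightarrow> \<bar>H z\<bar> \<le> B"
    unfolding sets_eq_imp_space_eq[OF \<rho>(2)] bounded_measurable_def measurable_cong_sets[OF \<rho>(2) refl] bounded_iff
    by auto
  then show ?thesis by (intro \<rho>.integrable_const_bound[where B=B]) auto
qed

text \<open>For \<open>t > 1\<close> causality allows replacing \<open>f\<close> by its conditional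
  mean, which is zero; for \<open>t = 1\<close> only the first marginal matters. Either way the
  value is the same for all causal plans.\<close>

lemma integral_A_set:
  assumes \<rho>: "\<rho> \<in> causal_plans X Y N \<mu>" and t: "t \<in> {1..N}" and f: "f \<in> A_set X Y N \<kappa> t"
  shows "(\<integral>z. f z \<partial>\<rho>) = (if t = 1 then \<integral>z. f z \<partial>P else 0)"
proof (cases "t = 1")
  case True
  then show ?thesis using integral_cyl_fst[OF \<rho> A_set_1] f N by simp
next
  case False
  then obtain u where u: "t = Suc u" "u \<in> {1..<N}" using t by (cases t) auto
  interpret kernels X Y N u \<kappa> by (rule \<kappa>_kernels[OF u(2)])
  note f' = A_set_Suc[OF u(2) f[unfolded u(1)]]
  have "(\<integral>z. f z \<partial>\<rho>) = (\<integral>z. intX \<kappa> u f z \<partial>\<rho>)"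
    by (rule causal_integral_intX[OF \<mu> reg_\<kappa> _ \<rho> f'(1)]) (use u in auto)
  also have "\<dots> = (\<integral>z. 0 \<partial>\<rho>)"
    by (rule Bochner_Integration.integral_cong) (use f'(2) sets_eq_imp_space_eq[OF causal_plansD(2)[OF \<rho>]] in auto)
  finally show ?thesis using False by simp
qed

section \<open>Densities of \<pi> on histories and the backward induction\<close>

context
  fixes f :: "nat \<Rightarrow> (nat \<Rightarrow> 'a) \<times> (nat \<Rightarrow> 'b) \<Rightarrow> real" and s :: "(nat \<Rightarrow> 'a) \<times> (nat \<Rightarrow> 'b) \<Rightarrow> real"
    and \<pi> :: "((nat \<Rightarrow> 'a) \<times> (nat \<Rightarrow> 'b)) measure"
  assumes f: "\<And>t. t \<in> {1..N} \<Longrightarrow> f t \<in> A_set X Y N \<kappa> t"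
    and s: "\<And>z. z \<in> \<Omega> \<Longrightarrow> s z = (\<Sum>t=1..N. f t z)"
    and \<pi>: "\<pi> \<in> causal_plans X Y N \<mu>" "\<pi> = density P (\<lambda>z. ennreal (exp (s z + g z)))"
begin

lemma S_cyl: "t \<le> N \<Longrightarrow> (\<lambda>z. \<Sum>i=1..t. f i z) \<in> cyl t t"
  by (rule cylinder_sum) (auto intro!: cylinder_mono[OF A_set_cyl[OF _ f]])

lemma s_cyl: "s \<in> cyl N N"
  by (rule cylinder_cong[OF S_cyl[OF order_refl] s])

text \<open>Only the first summand survives, with a value fixed by \<mu>. This constant turns out to
  be the minimal divergence.\<close>

lemma integral_s:
  assumes \<rho>: "\<rho> \<in> causal_plans X Y N \<mu>"
  shows "(\<integral>z. s z \<partial>\<rho>) = (\<integral>z. f 1 z \<partial>P)"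
proof -
  note \<rho>' = causal_plansD(1,2)[OF \<rho>]
  have "(\<integral>z. s z \<partial>\<rho>) = (\<integral>z. (\<Sum>t=1..N. f t z) \<partial>\<rho>)"
    by (rule Bochner_Integration.integral_cong) (use s sets_eq_imp_space_eq[OF \<rho>'(2)] in auto)
  also have "\<dots> = (\<Sum>t=1..N. \<integral>z. f t z \<partial>\<rho>)"
    by (rule Bochner_Integration.integral_sum) (auto intro!: integrable_plan_cyl[OF \<rho>' A_set_cyl[OF _ f]])
  also have "\<dots> = (\<Sum>t=1..N. if t = 1 then \<integral>z. f 1 z \<partial>P else 0)"
    by (rule sum.cong) (auto simp: integral_A_set[OF \<rho> _ f])
  also have "\<dots> = (\<integral>z. f 1 z \<partial>P)" using N by simp
  finally show ?thesis .
qed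

lemma integral_\<pi>:
  assumes F: "F \<in> cyl N N"
  shows "(\<integral>z. F z \<partial>\<pi>) = (\<integral>z. F z * exp (s z + g z) \<partial>P)"
proof -
  have [measurable]: "F \<in> borel_measurable P" "s \<in> borel_measurable P" "g \<in> borel_measurable P"
    using integrable_cyl[OF F] integrable_cyl[OF s_cyl] integrable_cyl[OF bounded_measurable_cylinder[OF g]] by auto
  show ?thesis unfolding \<pi>(2) by (subst integral_density) (auto simp: mult.commute)
qed

text \<open>This is the weak form of a density \<open>exp (f 1 + ... + f t + G t)\<close> for the
  pair of histories of length \<open>t\<close> under \<pi>. Testing with cylinder functions avoids
  marginal measures and their Radon-Nikodym derivatives.\<close>

abbreviation "density_at t \<equiv> \<forall>F \<in> cyl t t. (\<integral>z. F z \<partial>\<pi>) = (\<integral>z. F z * exp ((\<Sum>i=1..t. f i z) + G t z) \<partial>P)"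

lemma density_at_N: "density_at N"
proof
  fix F assume F: "F \<in> cyl N N"
  have "G N z = g z" if "z \<in> \<Omega>" for z
    using that by (cases z) (auto simp: G_def g_rec.simps[of N \<kappa> \<eta> g N] path_pair_def space_pair_measure proj_full)
  then show "(\<integral>z. F z \<partial>\<pi>) = (\<integral>z. F z * exp ((\<Sum>i=1..N. f i z) + G N z) \<partial>P)"
    unfolding integral_\<pi>[OF F] by (intro integral_P_cong) (simp add: s)
qed

text \<open>Both conclusions come from \<open>h = G t\<close> almost everywhere: by
  \<open>f_opt_Suc\<close> this is the formula for \<open>f (Suc t)\<close>, and inserted into the
  density \<open>E\<close> it is the induction step.\<close>

lemma density_at_step:
  assumes t: "t \<in> {1..<N}" and IH: "density_at (Suc t)"
  shows "AE z in P. f (Suc t) z = f_opt (Suc t) z" and "density_at t"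
proof -
  interpret kernels X Y N t \<kappa> by (rule \<kappa>_kernels[OF t])
  have le: "Suc t \<le> N" "t \<le> N" "1 \<le> t" using t by auto
  have St: "Suc t \<in> {1..N}" using t by auto
  define S where "S = (\<lambda>z. \<Sum>i=1..t. f i z)"
  \<comment> \<open>\<open>h\<close> compares the given potential with the recursion, and
    \<open>E\<close> is the density that remains once \<open>y (Suc t)\<close> is integrated
    out.\<close>
  define h where "h = (\<lambda>z. f (Suc t) z - A (Suc t) z)"
  define E where "E = (\<lambda>z. exp (S z + h z))"
  have S: "S \<in> cyl t t" unfolding S_def by (rule S_cyl[OF le(2)])
  have S': "S \<in> cyl (Suc t) t" by (rule cylinder_mono[OF S]) auto
  have fS: "f (Suc t) \<in> cyl (Suc t) t" "\<And>z. z \<in> \<Omega> \<Longrightarrow> intX \<kappa> t (f (Suc t)) z = 0"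
    using A_set_Suc[OF t f[OF St]] by auto
  have h: "h \<in> cyl (Suc t) t" unfolding h_def by (rule cylinder_diff[OF fS(1) A_cyl[OF t]])
  have E: "E \<in> cyl (Suc t) t" unfolding E_def by (rule cylinder_exp[OF cylinder_add[OF S' h]])
  \<comment> \<open>\<open>F\<close>, \<open>S\<close> and \<open>f (Suc t)\<close> ignore
    \<open>y (Suc t)\<close> and form the factor \<open>K\<close>; only
    \<open>exp (G (Suc t))\<close> is integrated, to \<open>exp (- A (Suc t))\<close>.\<close>
  have dens: "(\<integral>z. F z \<partial>\<pi>) = (\<integral>z. F z * E z \<partial>P)" if F: "F \<in> cyl (Suc t) t" for F
  proof -
    define K where "K = (\<lambda>z. F z * exp (S z + f (Suc t) z))"
    have K: "K \<in> cyl (Suc t) t"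
      unfolding K_def by (rule cylinder_mult[OF F cylinder_exp[OF cylinder_add[OF S' fS(1)]]])
    have K': "K \<in> cyl (Suc t) (Suc t)" by (rule cylinder_mono[OF K]) auto
    have "F \<in> cyl (Suc t) (Suc t)" by (rule cylinder_mono[OF F]) auto
    with IH have "(\<integral>z. F z \<partial>\<pi>) = (\<integral>z. F z * exp ((\<Sum>i=1..Suc t. f i z) + G (Suc t) z) \<partial>P)" by blast
    also have "\<dots> = (\<integral>z. K z * exp (G (Suc t) z) \<partial>P)"
      by (simp add: K_def S_def exp_add mult_ac)
    also have "\<dots> = (\<integral>z. intY \<eta> t (\<lambda>z. K z * exp (G (Suc t) z)) z \<partial>P)"
      by (rule integral_intY[OF \<mu> \<nu> reg_\<eta> le(3) _ cylinder_mult[OF K' cylinder_exp[OF G_cyl[OF St]]] le(1)])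
        (use t in auto)
    also have "\<dots> = (\<integral>z. K z * exp (- A (Suc t) z) \<partial>P)"
      by (rule integral_P_cong)
        (use t in \<open>simp add: intY_pull_out[of \<eta> t Y N, OF \<eta>_kernel[OF t] _ K] intY_G[OF t]\<close>)
    also have "\<dots> = (\<integral>z. F z * E z \<partial>P)"
      by (simp add: K_def E_def h_def mult.assoc exp_add[symmetric] algebra_simps)
    finally show ?thesis .
  qed
  \<comment> \<open>By causality \<pi> gives the same integral to \<open>F\<close> and to its
    projection; \<open>dens\<close> turns this into the orthogonality relation over
    \<open>P\<close>.\<close>
  have E_proj: "AE z in P. E z = intX \<kappa> t E z"
  proof (rule AE_eq_intX[OF t E])
    fix F assume F: "F \<in> cyl (Suc t) t"
    have "intX \<kappa> t F \<in> cyl (Suc t) t" by (rule cylinder_mono[OF intX_cylinder[OF F]]) auto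
    from dens[OF F] dens[OF this] causal_integral_intX[OF \<mu> reg_\<kappa> le(3) \<pi>(1) F]
    show "(\<integral>z. F z * E z \<partial>P) = (\<integral>z. intX \<kappa> t F z * E z \<partial>P)" by simp
  qed
  \<comment> \<open>A bound on the exponent supplies the level \<open>exp (- B)\<close> below
    \<open>E\<close>, so the cut-off in \<open>W\<close> has no effect where \<open>E\<close> equals
    its projection.\<close>
  have "(\<lambda>z. S z + h z) \<in> bounded_measurable (path_pair X Y N)"
    by (rule cylinder_bounded_measurable[OF cylinder_add[OF S' h]]) (use le in auto)
  then obtain B where B: "\<And>z. z \<in> \<Omega> \<Longrightarrow> \<bar>S z + h z\<bar> \<le> B"
    by (auto simp: bounded_measurable_def bounded_iff)
  \<comment> \<open>the truncation keeps \<open>W\<close> a bounded cylinder function on all of the space\<close>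
  define W where "W = (\<lambda>z. ln (max (exp (- B)) (intX \<kappa> t E z)) - S z)"
  have W: "W \<in> cyl t t"
    unfolding W_def by (rule cylinder_diff[OF cylinder_ln_max[OF _ intX_cylinder[OF E]] S]) simp
  \<comment> \<open>As \<open>E\<close> equals its projection, \<open>h = ln E - S\<close> is almost
    surely a function of the histories of length \<open>t\<close>.\<close>
  have "AE z in P. h z = W z"
    using E_proj AE_space
  proof eventually_elim
    case (elim z)
    have "exp (- B) \<le> E z" using B[of z] elim(2) by (simp add: E_def space_P abs_le_iff)
    then have "ln (max (exp (- B)) (E z)) = S z + h z" by (simp add: max_absorb2) (simp add: E_def)
    then show ?case using elim(1) by (simp add: W_def)
  qed
  from AE_eq_intX_of_AE_eq[OF t h W this] have hi: "AE z in P. h z = intX \<kappa> t h z" .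
  \<comment> \<open>\<open>f (Suc t)\<close> is conditionally centred and the projection of
    \<open>A (Suc t)\<close> is \<open>- G t\<close>, so only \<open>G t\<close> remains.\<close>
  have ih: "intX \<kappa> t h z = G t z" if "z \<in> \<Omega>" for z
    unfolding h_def using intX_diff[OF fS(1) A_cyl[OF t] le(2) that] fS(2)[OF that] intX_A[OF t] by simp
  have hG: "AE z in P. h z = G t z"
    using hi AE_space by eventually_elim (simp add: ih space_P)
  then show "AE z in P. f (Suc t) z = f_opt (Suc t) z"
    by eventually_elim (simp add: h_def f_opt_Suc[OF le(3)] del: One_nat_def)
  show "density_at t"
  proof
    fix F assume F: "F \<in> cyl t t"
    have F': "F \<in> cyl (Suc t) t" by (rule cylinder_mono[OF F]) auto
    have "(\<integral>z. F z * E z \<partial>P) = (\<integral>z. F z * exp (S z + G t z) \<partial>P)"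
    proof (rule integral_cong_AE)
      show "(\<lambda>z. F z * E z) \<in> borel_measurable P"
        using integrable_cyl[OF cylinder_mult[OF F' E] le(1,2)] by auto
      show "(\<lambda>z. F z * exp (S z + G t z)) \<in> borel_measurable P"
        using integrable_cyl[OF cylinder_mult[OF F cylinder_exp[OF cylinder_add[OF S G_cyl]]] le(2,2)] le by auto
      show "AE z in P. F z * E z = F z * exp (S z + G t z)"
        using hG by eventually_elim (simp add: E_def)
    qed
    then show "(\<integral>z. F z \<partial>\<pi>) = (\<integral>z. F z * exp ((\<Sum>i=1..t. f i z) + G t z) \<partial>P)"
      using dens[OF F'] by (simp add: S_def)
  qed
qed

lemma density_at_all: "t \<le> N \<Longrightarrow> 1 \<le> t \<Longrightarrow> density_at t"
proof (induction t rule: inc_induct)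
  case base show ?case by (rule density_at_N)
next
  case (step n)
  then have "n \<in> {1..<N}" by auto
  moreover have "density_at (Suc n)" using step.IH step.prems by simp
  ultimately show ?case by (rule density_at_step(2))
qed

text \<open>The law of the first \<open>y\<close>-coordinate is not among the conditional kernels,
  so this last integration goes through Fubini instead of \<open>intY\<close>. For fixed
  \<open>x\<close>, averaging \<open>exp (G 1)\<close> gives \<open>exp (- f_opt 1)\<close>.\<close>

lemma integral_exp_G_1:
  assumes K: "K \<in> cyl 1 0"
  shows "(\<integral>z. K z * exp (G 1 z) \<partial>P) = (\<integral>z. K z * exp (- f_opt 1 z) \<partial>P)"
proof -
  let ?\<nu>1 = "distr \<nu> (borel_of (Y 1)) (\<lambda>y. y 1)"
  have m1: "(\<lambda>y. y 1) \<in> measurable \<nu> (borel_of (Y 1))"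
    unfolding measurable_cong_sets[OF sets_\<nu> refl] by (rule component_measurable) (use N in auto)
  obtain k where k: "\<forall>x y. (x, y) \<in> \<Omega> \<longrightarrow> K (x, y) = k (proj 1 x, proj 0 y)"
    using cylinderE[OF K] by metis
  have Kc: "K (x, y) = K (x, y')" if "(x, y) \<in> \<Omega>" "(x, y') \<in> \<Omega>" for x y y'
    using k that by (auto simp: proj_def restrict_def)
  have fo: "f_opt 1 \<in> cyl 1 0" using f_opt_A_set[of 1] N A_set_1 by auto
  have "(\<lambda>z. exp (G 1 z)) \<in> cyl 1 1" using cylinder_exp[OF G_cyl[of 1]] N by simp
  note G1 = this
  have K1: "K \<in> cyl 1 1" by (rule cylinder_mono[OF K]) auto
  have i1: "integrable P (\<lambda>z. K z * exp (G 1 z))"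
    by (rule integrable_cyl[OF cylinder_mult[OF K1 G1]]) (use N in auto)
  have "(\<lambda>z. exp (- f_opt 1 z)) \<in> cyl 1 0"
    using cylinder_exp[OF cylinder_diff[OF cylinder_const[of 0] fo]] by simp
  from integrable_cyl[OF cylinder_mult[OF K this]] N
  have i2: "integrable P (\<lambda>z. K z * exp (- f_opt 1 z))" by simp
  have "(\<integral>z. K z * exp (G 1 z) \<partial>P) = (\<integral>x. \<integral>y. K (x, y) * exp (G 1 (x, y)) \<partial>\<nu> \<partial>\<mu>)"
    using integral_fst'[OF i1] by simp
  also have "\<dots> = (\<integral>x. \<integral>y. K (x, y) * exp (- f_opt 1 (x, y)) \<partial>\<nu> \<partial>\<mu>)"
  proof (rule Bochner_Integration.integral_cong[OF refl])
    fix x assume x: "x \<in> space \<mu>"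
    then have xN: "x \<in> space (hist X N)" using sets_eq_imp_space_eq[OF sets_\<mu>] by simp
    have xy: "(x, y) \<in> \<Omega>" if "y \<in> space \<nu>" for y
      using x that by (simp add: space_P[symmetric] space_pair_measure)
    \<comment> \<open>\<open>K\<close> is constant in \<open>y\<close>, so its value at any one
      point can be taken out of the inner integral.\<close>
    obtain y0 where y0: "y0 \<in> space \<nu>" using \<nu>.not_empty by blast
    have x1: "proj 1 x \<in> space (hist X 1)" using measurable_space[OF proj_measurable[OF N] xN] .
    let ?p = "\<lambda>b. g_rec N \<kappa> \<eta> g 1 (proj 1 x, \<lambda>i\<in>{1}. b)"
    from measurable_compose[OF singleton_measurable measurable_Pair1'[OF x1]]
    have "(\<lambda>b. (proj 1 x, \<lambda>i\<in>{1}. b)) \<in> measurable (borel_of (Y 1)) (hist X 1 \<Otimes>\<^sub>M hist Y 1)" .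
    from bounded_measurable_compose[OF g_rec_bounded_measurable[of 1] this] N
    have p: "?p \<in> bounded_measurable (borel_of (Y 1))" by simp
    then obtain B where B: "\<And>b. b \<in> space (borel_of (Y 1)) \<Longrightarrow> \<bar>?p b\<bar> \<le> B"
      by (auto simp: bounded_measurable_def bounded_iff)
    have pm: "?p \<in> borel_measurable (borel_of (Y 1))" using p by (simp add: bounded_measurable_def)
    have "exp (- B) \<le> (\<integral>b. exp (?p b) \<partial>?\<nu>1)"
      by (rule prob_space_exp_integral_ge[OF \<nu>.prob_space_distr[OF m1]]) (use pm B in auto)
    moreover have "0 < exp (- B)" by simp
    ultimately have "0 < (\<integral>b. exp (?p b) \<partial>?\<nu>1)" by linarith
    then have Z: "exp (- f_opt 1 (x, y)) = (\<integral>b. exp (?p b) \<partial>?\<nu>1)" for y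
      by (simp add: f_rec_def)
    have pj: "proj 1 y = (\<lambda>i\<in>{1}. y 1)" for y :: "nat \<Rightarrow> 'b" by (auto simp: proj_def fun_eq_iff)
    have "(\<integral>y. K (x, y) * exp (G 1 (x, y)) \<partial>\<nu>) = (\<integral>y. K (x, y0) * exp (?p (y 1)) \<partial>\<nu>)"
      by (rule Bochner_Integration.integral_cong[OF refl])
        (use Kc[OF xy xy[OF y0]] in \<open>simp add: G_def pj del: One_nat_def\<close>)
    also have "\<dots> = K (x, y0) * (\<integral>b. exp (?p b) \<partial>?\<nu>1)"
      using pm by (subst integral_distr[OF m1]) auto
    also have "\<dots> = (\<integral>y. K (x, y0) * (\<integral>b. exp (?p b) \<partial>?\<nu>1) \<partial>\<nu>)"
      by (simp add: \<nu>.prob_space)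
    also have "\<dots> = (\<integral>y. K (x, y) * exp (- f_opt 1 (x, y)) \<partial>\<nu>)"
      by (rule Bochner_Integration.integral_cong[OF refl]) (use Kc[OF xy xy[OF y0]] Z in simp)
    finally show "(\<integral>y. K (x, y) * exp (G 1 (x, y)) \<partial>\<nu>) = (\<integral>y. K (x, y) * exp (- f_opt 1 (x, y)) \<partial>\<nu>)" .
  qed
  also have "\<dots> = (\<integral>z. K z * exp (- f_opt 1 z) \<partial>P)"
    using integral_fst'[OF i2] by simp
  finally show ?thesis .
qed

text \<open>\<open>E\<close> is the density of the first \<open>x\<close>-coordinate under \<pi>
  relative to its law under \<mu>. As \<pi> has first marginal \<mu>, testing with
  \<open>D = E - 1\<close> shows that \<open>D\<close> has zero norm.\<close>

lemma f_1_eq: "AE z in P. f 1 z = f_opt 1 z"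
proof -
  have f1: "f 1 \<in> cyl 1 0" using A_set_1 f[of 1] N by simp
  have fo: "f_opt 1 \<in> cyl 1 0" using f_opt_A_set[of 1] N A_set_1 by auto
  define E where "E = (\<lambda>z. exp (f 1 z - f_opt 1 z))"
  have E: "E \<in> cyl 1 0" unfolding E_def by (rule cylinder_exp[OF cylinder_diff[OF f1 fo]])
  define D where "D = (\<lambda>z. E z - 1)"
  have D: "D \<in> cyl 1 0" unfolding D_def by (rule cylinder_diff[OF E cylinder_const])
  have D1: "D \<in> cyl 1 1" by (rule cylinder_mono[OF D]) auto
  have "(\<integral>z. D z \<partial>P) = (\<integral>z. D z \<partial>\<pi>)" using integral_cyl_fst[OF \<pi>(1) D N] by simp
  also have "\<dots> = (\<integral>z. D z * exp ((\<Sum>i=1..1. f i z) + G 1 z) \<partial>P)"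
    using density_at_all[OF N] D1 by blast
  also have "\<dots> = (\<integral>z. (D z * exp (f 1 z)) * exp (G 1 z) \<partial>P)"
    by (simp add: exp_add mult.assoc)
  also have "\<dots> = (\<integral>z. (D z * exp (f 1 z)) * exp (- f_opt 1 z) \<partial>P)"
    by (rule integral_exp_G_1[OF cylinder_mult[OF D cylinder_exp[OF f1]]])
  also have "\<dots> = (\<integral>z. D z * E z \<partial>P)"
    by (simp add: E_def exp_diff exp_minus field_simps)
  finally have eq: "(\<integral>z. D z \<partial>P) = (\<integral>z. D z * E z \<partial>P)" .
  have int: "integrable P D" "integrable P (\<lambda>z. D z * E z)"
    using integrable_cyl[OF D] integrable_cyl[OF cylinder_mult[OF D E]] N by auto
  have "(\<integral>z. D z * D z \<partial>P) = (\<integral>z. D z * E z - D z \<partial>P)"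
    by (rule integral_P_cong) (simp add: D_def algebra_simps)
  also have "\<dots> = 0" using int eq by simp
  finally have "AE z in P. D z = 0" by (rule AE_zero_cyl[OF D N le0])
  then show ?thesis by eventually_elim (simp add: D_def E_def)
qed

lemma s_eq_f_opt: "AE z in P. s z = (\<Sum>t=1..N. f_opt t z)"
proof -
  have "AE z in P. f t z = f_opt t z" if t: "t \<in> {1..N}" for t
  proof (cases "t = 1")
    case True then show ?thesis using f_1_eq by simp
  next
    case False
    then obtain u where u: "t = Suc u" "u \<in> {1..<N}" using t by (cases t) auto
    with t density_at_all[of "Suc u"] density_at_step(1)[OF u(2)] show ?thesis by simp
  qed
  then have "AE z in P. \<forall>t\<in>{1..N}. f t z = f_opt t z"
    by (subst AE_finite_all) auto
  then show ?thesis using AE_space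
    by eventually_elim (simp add: s space_P)
qed

end

end

section \<open>Minimality, uniqueness and the conclusion\<close>

text \<open>On \<open>C\<close> the lower bound for the divergence is the constant \<open>c\<close>,
  which \<pi> attains; the equality case of the bound gives uniqueness.\<close>

lemma is_arg_min_D_KL:
  assumes "prob_space \<gamma>" "s \<in> borel_measurable \<gamma>" "\<pi> = density \<gamma> (\<lambda>z. ennreal (exp (s z)))"
    and \<pi>: "\<pi> \<in> C"
    and C: "\<And>\<rho>. \<rho> \<in> C \<Longrightarrow> prob_space \<rho> \<and> sets \<rho> = sets \<gamma> \<and> integrable \<rho> s \<and> (\<integral>z. s z \<partial>\<rho>) = c"
  shows "is_arg_min (\<lambda>\<rho>. D_KL \<rho> \<gamma>) (\<lambda>\<rho>. \<rho> \<in> C) \<pi>"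
    and "is_arg_min (\<lambda>\<rho>. D_KL \<rho> \<gamma>) (\<lambda>\<rho>. \<rho> \<in> C) \<rho> \<Longrightarrow> \<rho> = \<pi>"
proof -
  interpret \<gamma>: prob_space \<gamma> by fact
  have D\<pi>: "D_KL \<pi> \<gamma> = ereal c"
    using D_KL_exp_density[OF assms(2) \<gamma>.sigma_finite_measure_axioms assms(3)] C[OF \<pi>] by simp
  have lower: "ereal c \<le> D_KL \<rho> \<gamma>" "D_KL \<rho> \<gamma> = ereal c \<Longrightarrow> \<rho> = \<pi>" if "\<rho> \<in> C" for \<rho>
    using D_KL_lower_bound[OF assms(2,1) _ assms(3), of \<rho>] C[OF \<pi>] C[OF that] by auto
  show "is_arg_min (\<lambda>\<rho>. D_KL \<rho> \<gamma>) (\<lambda>\<rho>. \<rho> \<in> C) \<pi>"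
    using \<pi> lower(1) D\<pi> by (auto simp: is_arg_min_def not_less)
  assume "is_arg_min (\<lambda>\<rho>. D_KL \<rho> \<gamma>) (\<lambda>\<rho>. \<rho> \<in> C) \<rho>"
  then have \<rho>: "\<rho> \<in> C" "\<not> D_KL \<pi> \<gamma> < D_KL \<rho> \<gamma>"
    using \<pi> by (auto simp: is_arg_min_def)
  with lower[OF \<rho>(1)] D\<pi> show "\<rho> = \<pi>" by auto
qed

theorem lemma6p4:
  fixes N :: nat
    and X :: "nat \<Rightarrow> 'a topology" and Y :: "nat \<Rightarrow> 'b topology"
    and \<mu> :: "(nat \<Rightarrow> 'a) measure" and \<nu> :: "(nat \<Rightarrow> 'b) measure"
    and \<kappa> :: "nat \<Rightarrow> (nat \<Rightarrow> 'a) \<Rightarrow> 'a measure" and \<eta> :: "nat \<Rightarrow> (nat \<Rightarrow> 'b) \<Rightarrow> 'b measure"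
    and P \<gamma> \<pi> :: "((nat \<Rightarrow> 'a) \<times> (nat \<Rightarrow> 'b)) measure"
    and g s :: "(nat \<Rightarrow> 'a) \<times> (nat \<Rightarrow> 'b) \<Rightarrow> real"
  assumes "1 \<le> N"
    and "\<And>t. t \<in> {1..N} \<Longrightarrow> polish_space (X t)"
    and "\<And>t. t \<in> {1..N} \<Longrightarrow> polish_space (Y t)"
    and "\<mu> \<in> space (prob_algebra (hist X N))"
    and "\<nu> \<in> space (prob_algebra (hist Y N))"
    and "regular_cond_laws X N \<mu> \<kappa>"
    and "regular_cond_laws Y N \<nu> \<eta>"
    and "P = \<mu> \<Otimes>\<^sub>M \<nu>"
    and "\<gamma> \<in> space (prob_algebra (path_pair X Y N))"
    and "g \<in> bounded_measurable (path_pair X Y N)"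
    and "\<gamma> = density P (\<lambda>z. ennreal (exp (g z)))"
    and "\<pi> \<in> causal_plans X Y N \<mu>"
    and "s \<in> S_set X Y N \<kappa>"
    and "\<pi> = density P (\<lambda>z. ennreal (exp (s z + g z)))"
  shows "is_arg_min (\<lambda>\<rho>. D_KL \<rho> \<gamma>) (\<lambda>\<rho>. \<rho> \<in> causal_plans X Y N \<mu>) \<pi> \<and>
    (\<forall>\<rho>. is_arg_min (\<lambda>\<rho>. D_KL \<rho> \<gamma>) (\<lambda>\<rho>. \<rho> \<in> causal_plans X Y N \<mu>) \<rho> \<longrightarrow> \<rho> = \<pi>) \<and>
    (\<forall>t\<in>{1..N}. f_rec N \<kappa> (distr \<nu> (borel_of (Y 1)) (\<lambda>y. y 1)) \<eta> g t \<in> A_set X Y N \<kappa> t) \<and>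
    (AE z in P. s z = (\<Sum>t=1..N. f_rec N \<kappa> (distr \<nu> (borel_of (Y 1)) (\<lambda>y. y 1)) \<eta> g t z))"
proof -
  interpret causal_problem N X Y \<mu> \<nu> \<kappa> \<eta> g
    by unfold_locales (use assms in auto)
  have P: "P = \<mu> \<Otimes>\<^sub>M \<nu>" by fact
  obtain f where f: "\<And>t. t \<in> {1..N} \<Longrightarrow> f t \<in> A_set X Y N \<kappa> t"
    and s: "\<And>z. z \<in> space (path_pair X Y N) \<Longrightarrow> s z = (\<Sum>t=1..N. f t z)"
    using \<open>s \<in> S_set X Y N \<kappa>\<close> unfolding S_set_def by blast
  note \<pi> = \<open>\<pi> \<in> causal_plans X Y N \<mu>\<close> \<open>\<pi> = density P _\<close>[unfolded P]
  note s_cyl = s_cyl[OF f s \<pi>]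
  have sg: "s \<in> borel_measurable (\<mu> \<Otimes>\<^sub>M \<nu>)" "g \<in> borel_measurable (\<mu> \<Otimes>\<^sub>M \<nu>)"
    using integrable_cyl[OF s_cyl] integrable_cyl[OF bounded_measurable_cylinder[OF g]] by auto
  have \<gamma>: "\<gamma> = density (\<mu> \<Otimes>\<^sub>M \<nu>) (\<lambda>z. ennreal (exp (g z)))"
    using assms by simp
  \<comment> \<open>The chain rule for densities: \<gamma> already carries the factor
    \<open>exp g\<close>, so \<open>exp s\<close> alone leads from \<gamma> to \<pi>.\<close>
  have "density \<gamma> (\<lambda>z. ennreal (exp (s z))) = \<pi>"
    unfolding \<gamma> \<pi>(2) using sg
    by (subst density_density_eq) (auto simp: ennreal_mult[symmetric] exp_add mult.commute intro!: density_cong)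
  note dens = this[symmetric]
  have pr: "prob_space \<gamma>" and sets_\<gamma>: "sets \<gamma> = sets (path_pair X Y N)"
    using \<open>\<gamma> \<in> _\<close> by (auto simp: space_prob_algebra)
  have s\<gamma>: "s \<in> borel_measurable \<gamma>" using sg(1) by (simp add: \<gamma>)
  \<comment> \<open>The constant required by \<open>is_arg_min_D_KL\<close> is the integral of
    \<open>f 1\<close>, as the conditionally centred summands contribute nothing under any causal
    plan.\<close>
  have plans: "prob_space \<rho> \<and> sets \<rho> = sets \<gamma> \<and> integrable \<rho> s \<and> (\<integral>z. s z \<partial>\<rho>) = (\<integral>z. f 1 z \<partial>(\<mu> \<Otimes>\<^sub>M \<nu>))"
    if "\<rho> \<in> causal_plans X Y N \<mu>" for \<rho>
    using causal_plansD[OF that] sets_\<gamma> integrable_plan_cyl[OF _ _ s_cyl] integral_s[OF f s \<pi> that] by auto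
  have "is_arg_min (\<lambda>\<rho>. D_KL \<rho> \<gamma>) (\<lambda>\<rho>. \<rho> \<in> causal_plans X Y N \<mu>) \<pi>"
    by (rule is_arg_min_D_KL(1)[OF pr s\<gamma> dens \<pi>(1) plans])
  moreover have "\<rho> = \<pi>" if "is_arg_min (\<lambda>\<rho>. D_KL \<rho> \<gamma>) (\<lambda>\<rho>. \<rho> \<in> causal_plans X Y N \<mu>) \<rho>" for \<rho>
    by (rule is_arg_min_D_KL(2)[OF pr s\<gamma> dens \<pi>(1) plans that])
  ultimately show ?thesis
    unfolding P using f_opt_A_set s_eq_f_opt[OF f s \<pi>] by blast
qed

end
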